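(* The resolution functor $P^\bullet:(\mathrm{Pers}(\mathbb{R}^n),d_I)\to (K(\mathrm{Pers}(\mathbb{R}^n)),d_I^K)$ is distance preserving, i.e. for all persistence modules $M,N$ over $\mathbb{R}^n$, $$d_I^K(P^\bullet(M),P^\bullet(N))=d_I(M,N).$$
   Context: Fix a field $\mathbf{k}$ and an integer $n>0$; $\mathbb{R}^n$ carries the product partial order, viewed as a poset category. A persistence module over $\mathbb{R}^n$ is a functor $(\mathbb{R}^n,\le)\to\mathrm{Mod}(\mathbf{k})$ (the category of $\mathbf{k}$-vector spaces); with natural transformations these form the abelian category $\mathrm{Pers}(\mathbb{R}^n)$, which has enough projectives. Shift and smoothing. For $\varepsilon\in\mathbb{R}$, $M[\varepsilon]$ is defined by $M[\varepsilon](s)=M(s+(\varepsilon,\dots,\varepsilon))$ and $M[\varepsilon](s\le t)=M(s+(\varepsilon,\dots,\varepsilon)\le t+(\varepsilon,\dots,\varepsilon))$; this is an endofunctor. For $\varepsilon\ge 0$, $s_\varepsilon^M:M\to M[\varepsilon]$ is the morphism with components $M(t\le t+(\varepsilon,\dots,\varepsilon))$. Interleaving distance. For $\varepsilon\ge0$, $M,N$ are $\varepsilon$-interleaved ($M\sim_\varepsilon N$) if there are $f:M\to N[\varepsilon]$, $g:N\to M[\varepsilon]$ with $g[\varepsilon]\circ f=s_{2\varepsilon}^M$ and $f[\varepsilon]\circ g=s_{2\varepsilon}^N$; $d_I(M,N)=\inf\{\varepsilon\in\mathbb{R}_{\ge0}\mid M\sim_\varepsilon N\}\in[0,+\infty]$.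 Homotopy interleaving distance. $K(\mathrm{Pers}(\mathbb{R}^n))$ has as objects cochain complexes of persistence modules and as morphisms chain maps modulo chain homotopy. For a complex $X$, $X[\varepsilon]$ denotes the functor $[\varepsilon]$ applied degreewise (NOT the homological degree shift); this induces an endofunctor of $K(\mathrm{Pers}(\mathbb{R}^n))$. $[s_\varepsilon^X]$ is the homotopy class of the chain map $X\to X[\varepsilon]$ equal to $s_\varepsilon^{X^i}$ in degree $i$. $X,Y$ are $\varepsilon$-interleaved ($X\sim^K_\varepsilon Y$) if there are morphisms $f:X\to Y[\varepsilon]$, $g:Y\to X[\varepsilon]$ of $K(\mathrm{Pers}(\mathbb{R}^n))$ with $g[\varepsilon]\circ f=[s_{2\varepsilon}^X]$ and $f[\varepsilon]\circ g=[s_{2\varepsilon}^Y]$; $d_I^K(X,Y)=\inf\{\varepsilon\in\mathbb{R}_{\ge0}\mid X\sim_\varepsilon^K Y\}\in[0,+\infty]$. Resolution functor. $P^\bullet:\mathrm{Pers}(\mathbb{R}^n)\to K(\mathrm{Pers}(\mathbb{R}^n))$ is a fixed resolution functor: for each $M$ a projective resolution $P^\bullet(M)$ is chosen (a complex of projectives in degrees $\le 0$, with $\mathrm{H}^j=0$ for $j\ne0$ and $\mathrm{H}^0(P^\bullet(M))\simeq M$), and a morphism $f$ is sent to the homotopy class of any chain map lifting $f$. *)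

theory Defs
  imports "HOL-Analysis.Analysis" "HOL-Algebra.Module" "HOL-Algebra.AbelCoset"
begin

section \<open>Persistence modules over \<open>\<real>\<^sup>n\<close>\<close>

text \<open>
  The ground field is a HOL-Algebra ring \<open>K\<close> with \<open>field K\<close>; vector spaces over \<open>K\<close> are
  HOL-Algebra modules over \<open>K\<close>, with elements drawn from a type \<open>'v\<close>. The type \<open>'v\<close> is a type
  variable throughout and plays the role of the universe in which \<open>Pers(\<real>\<^sup>n)\<close> is formed.
  For every \<open>'v\<close> this category has kernels and cokernels (represent quotients by complements);
  if \<open>'v\<close> is infinite of cardinality at least \<open>|K|\<close> and \<open>2\<^sup>\<aleph>\<^sup>0\<close>, it has finite direct sums and
  enough projectives, and its projectives are then summands of free persistence modules.
  The index space is \<open>real ^ 'n\<close>, whose library order is the product order.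

  Functions representing morphisms are only meaningful on carriers, and transition maps
  only at \<open>s \<le> t\<close>; equality of morphisms is agreement on carriers.
\<close>

record ('n, 'k, 'v) persmod =
  fib :: "real ^ ('n::finite) \<Rightarrow> ('k, 'v) module"
  tr :: "real ^ 'n \<Rightarrow> real ^ 'n \<Rightarrow> 'v \<Rightarrow> 'v"

definition linear_maps ::
  "('k, 'r) ring_scheme \<Rightarrow> ('k, 'v) module \<Rightarrow> ('k, 'w) module \<Rightarrow> ('v \<Rightarrow> 'w) set" where
  "linear_maps K V W = {f. f \<in> carrier V \<rightarrow> carrier W \<and>
     (\<forall>x\<in>carrier V. \<forall>y\<in>carrier V. f (x \<oplus>\<^bsub>V\<^esub> y) = f x \<oplus>\<^bsub>W\<^esub> f y) \<and>
     (\<forall>a\<in>carrier K. \<forall>x\<in>carrier V. f (a \<odot>\<^bsub>V\<^esub> x) = a \<odot>\<^bsub>W\<^esub> f x)}"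

definition persistence_module ::
  "('k, 'r) ring_scheme \<Rightarrow> ('n::finite, 'k, 'v) persmod \<Rightarrow> bool" where
  "persistence_module K M \<longleftrightarrow>
     (\<forall>s. Module.module K (fib M s)) \<and>
     (\<forall>s t. s \<le> t \<longrightarrow> tr M s t \<in> linear_maps K (fib M s) (fib M t)) \<and>
     (\<forall>s. \<forall>x\<in>carrier (fib M s). tr M s s x = x) \<and>
     (\<forall>s t u. s \<le> t \<longrightarrow> t \<le> u \<longrightarrow>
        (\<forall>x\<in>carrier (fib M s). tr M t u (tr M s t x) = tr M s u x))"

definition pers_hom ::
  "('k, 'r) ring_scheme \<Rightarrow> ('n::finite, 'k, 'v) persmod \<Rightarrow> ('n, 'k, 'w) persmod
     \<Rightarrow> (real ^ 'n \<Rightarrow> 'v \<Rightarrow> 'w) set" where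
  "pers_hom K M N = {f. (\<forall>s. f s \<in> linear_maps K (fib M s) (fib N s)) \<and>
     (\<forall>s t. s \<le> t \<longrightarrow> (\<forall>x\<in>carrier (fib M s). f t (tr M s t x) = tr N s t (f s x)))}"

definition pers_eq ::
  "('n::finite, 'k, 'v) persmod \<Rightarrow> (real ^ 'n \<Rightarrow> 'v \<Rightarrow> 'w) \<Rightarrow> (real ^ 'n \<Rightarrow> 'v \<Rightarrow> 'w) \<Rightarrow> bool" where
  "pers_eq M f g \<longleftrightarrow> (\<forall>s. \<forall>x\<in>carrier (fib M s). f s x = g s x)"

definition pers_id :: "real ^ ('n::finite) \<Rightarrow> 'v \<Rightarrow> 'v" where
  "pers_id = (\<lambda>s x. x)"

definition pers_comp ::
  "(real ^ ('n::finite) \<Rightarrow> 'v \<Rightarrow> 'w) \<Rightarrow> (real ^ 'n \<Rightarrow> 'u \<Rightarrow> 'v) \<Rightarrow> real ^ 'n \<Rightarrow> 'u \<Rightarrow> 'w" where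
  "pers_comp g f = (\<lambda>s x. g s (f s x))"

definition pers_iso ::
  "('k, 'r) ring_scheme \<Rightarrow> ('n::finite, 'k, 'v) persmod \<Rightarrow> ('n, 'k, 'w) persmod
     \<Rightarrow> (real ^ 'n \<Rightarrow> 'v \<Rightarrow> 'w) \<Rightarrow> bool" where
  "pers_iso K M N f \<longleftrightarrow> f \<in> pers_hom K M N \<and>
     (\<exists>g\<in>pers_hom K N M. pers_eq M (pers_comp g f) pers_id \<and> pers_eq N (pers_comp f g) pers_id)"

definition pers_zero :: "('n::finite, 'k, 'v) persmod \<Rightarrow> bool" where
  "pers_zero M \<longleftrightarrow> (\<forall>s. carrier (fib M s) = {\<zero>\<^bsub>fib M s\<^esub>})"

definition pers_epi ::
  "('k, 'r) ring_scheme \<Rightarrow> ('n::finite, 'k, 'v) persmod \<Rightarrow> ('n, 'k, 'v) persmod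
     \<Rightarrow> (real ^ 'n \<Rightarrow> 'v \<Rightarrow> 'v) \<Rightarrow> bool" where
  "pers_epi K M N e \<longleftrightarrow> e \<in> pers_hom K M N \<and>
     (\<forall>L :: ('n, 'k, 'v) persmod. persistence_module K L \<longrightarrow>
        (\<forall>g\<in>pers_hom K N L. \<forall>h\<in>pers_hom K N L.
           pers_eq M (pers_comp g e) (pers_comp h e) \<longrightarrow> pers_eq N g h))"

definition pers_projective ::
  "('k, 'r) ring_scheme \<Rightarrow> ('n::finite, 'k, 'v) persmod \<Rightarrow> bool" where
  "pers_projective K Q \<longleftrightarrow> persistence_module K Q \<and>
     (\<forall>(M :: ('n, 'k, 'v) persmod) (N :: ('n, 'k, 'v) persmod) e f.
        persistence_module K M \<longrightarrow> persistence_module K N \<longrightarrow>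
        pers_epi K M N e \<longrightarrow> f \<in> pers_hom K Q N \<longrightarrow>
        (\<exists>g\<in>pers_hom K Q M. pers_eq Q (pers_comp e g) f))"

section \<open>Shift, smoothing and the interleaving distance\<close>

definition pshift :: "real \<Rightarrow> ('n::finite, 'k, 'v) persmod \<Rightarrow> ('n, 'k, 'v) persmod" where
  "pshift \<epsilon> M = \<lparr>fib = (\<lambda>s. fib M (s + vec \<epsilon>)), tr = (\<lambda>s t. tr M (s + vec \<epsilon>) (t + vec \<epsilon>))\<rparr>"

definition pshift_map ::
  "real \<Rightarrow> (real ^ ('n::finite) \<Rightarrow> 'v \<Rightarrow> 'w) \<Rightarrow> real ^ 'n \<Rightarrow> 'v \<Rightarrow> 'w" where
  "pshift_map \<epsilon> f = (\<lambda>s. f (s + vec \<epsilon>))"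

definition smoothing :: "real \<Rightarrow> ('n::finite, 'k, 'v) persmod \<Rightarrow> real ^ 'n \<Rightarrow> 'v \<Rightarrow> 'v" where
  "smoothing \<epsilon> M = (\<lambda>s. tr M s (s + vec \<epsilon>))"

text \<open>Composites into \<open>M[\<epsilon>][\<epsilon>]\<close> are compared below with morphisms into \<open>M[2\<epsilon>]\<close>.\<close>

lemma pshift_pshift: "pshift \<epsilon> (pshift \<delta> M) = pshift (\<epsilon> + \<delta>) M"
  by (simp add: pshift_def add.assoc vec_add)

definition interleaved ::
  "('k, 'r) ring_scheme \<Rightarrow> real \<Rightarrow> ('n::finite, 'k, 'v) persmod \<Rightarrow> ('n, 'k, 'w) persmod \<Rightarrow> bool" where
  "interleaved K \<epsilon> M N \<longleftrightarrow>
     (\<exists>f\<in>pers_hom K M (pshift \<epsilon> N). \<exists>g\<in>pers_hom K N (pshift \<epsilon> M).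
        pers_eq M (pers_comp (pshift_map \<epsilon> g) f) (smoothing (2 * \<epsilon>) M) \<and>
        pers_eq N (pers_comp (pshift_map \<epsilon> f) g) (smoothing (2 * \<epsilon>) N))"

definition d_I ::
  "('k, 'r) ring_scheme \<Rightarrow> ('n::finite, 'k, 'v) persmod \<Rightarrow> ('n, 'k, 'w) persmod \<Rightarrow> ennreal" where
  "d_I K M N = Inf (ennreal ` {\<epsilon>. 0 \<le> \<epsilon> \<and> interleaved K \<epsilon> M N})"

section \<open>Cochain complexes and the homotopy category\<close>

record ('n, 'k, 'v) pcomplex =
  ob :: "int \<Rightarrow> ('n::finite, 'k, 'v) persmod"
  df :: "int \<Rightarrow> real ^ 'n \<Rightarrow> 'v \<Rightarrow> 'v"

type_synonym ('n, 'v, 'w) pgraded_map = "int \<Rightarrow> real ^ 'n \<Rightarrow> 'v \<Rightarrow> 'w"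

definition cochain_complex ::
  "('k, 'r) ring_scheme \<Rightarrow> ('n::finite, 'k, 'v) pcomplex \<Rightarrow> bool" where
  "cochain_complex K X \<longleftrightarrow>
     (\<forall>i. persistence_module K (ob X i)) \<and>
     (\<forall>i. df X i \<in> pers_hom K (ob X i) (ob X (i + 1))) \<and>
     (\<forall>i s. \<forall>x\<in>carrier (fib (ob X i) s).
        df X (i + 1) s (df X i s x) = \<zero>\<^bsub>fib (ob X (i + 1 + 1)) s\<^esub>)"

definition chain_maps ::
  "('k, 'r) ring_scheme \<Rightarrow> ('n::finite, 'k, 'v) pcomplex \<Rightarrow> ('n, 'k, 'w) pcomplex
     \<Rightarrow> ('n, 'v, 'w) pgraded_map set" where
  "chain_maps K X Y = {\<phi>. (\<forall>i. \<phi> i \<in> pers_hom K (ob X i) (ob Y i)) \<and>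
     (\<forall>i. pers_eq (ob X i) (pers_comp (\<phi> (i + 1)) (df X i)) (pers_comp (df Y i) (\<phi> i)))}"

definition homotopy_rel ::
  "('k, 'r) ring_scheme \<Rightarrow> ('n::finite, 'k, 'v) pcomplex \<Rightarrow> ('n, 'k, 'w) pcomplex
     \<Rightarrow> ('n, 'v, 'w) pgraded_map rel" where
  "homotopy_rel K X Y = {(\<phi>, \<psi>). \<phi> \<in> chain_maps K X Y \<and> \<psi> \<in> chain_maps K X Y \<and>
     (\<exists>h. (\<forall>i. h i \<in> pers_hom K (ob X i) (ob Y (i - 1))) \<and>
        (\<forall>i s. \<forall>x\<in>carrier (fib (ob X i) s).
           \<phi> i s x \<ominus>\<^bsub>fib (ob Y i) s\<^esub> \<psi> i s x =
           df Y (i - 1) s (h i s x) \<oplus>\<^bsub>fib (ob Y i) s\<^esub> h (i + 1) s (df X i s x)))}"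

text \<open>Morphisms of \<open>K(Pers(\<real>\<^sup>n))\<close> are homotopy classes, represented as sets of chain maps.\<close>

definition K_class ::
  "('k, 'r) ring_scheme \<Rightarrow> ('n::finite, 'k, 'v) pcomplex \<Rightarrow> ('n, 'k, 'w) pcomplex
     \<Rightarrow> ('n, 'v, 'w) pgraded_map \<Rightarrow> ('n, 'v, 'w) pgraded_map set" where
  "K_class K X Y \<phi> = homotopy_rel K X Y `` {\<phi>}"

definition K_hom ::
  "('k, 'r) ring_scheme \<Rightarrow> ('n::finite, 'k, 'v) pcomplex \<Rightarrow> ('n, 'k, 'w) pcomplex
     \<Rightarrow> ('n, 'v, 'w) pgraded_map set set" where
  "K_hom K X Y = chain_maps K X Y // homotopy_rel K X Y"

text \<open>The composite \<open>G \<circ> F\<close> with source \<open>X\<close> and target \<open>Z\<close>.\<close>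

definition K_comp ::
  "('k, 'r) ring_scheme \<Rightarrow> ('n::finite, 'k, 'u) pcomplex \<Rightarrow> ('n, 'k, 'w) pcomplex
     \<Rightarrow> ('n, 'v, 'w) pgraded_map set \<Rightarrow> ('n, 'u, 'v) pgraded_map set
     \<Rightarrow> ('n, 'u, 'w) pgraded_map set" where
  "K_comp K X Z G F = (\<Union>\<gamma>\<in>G. \<Union>\<phi>\<in>F. K_class K X Z (\<lambda>i. pers_comp (\<gamma> i) (\<phi> i)))"

text \<open>The functor \<open>[\<epsilon>]\<close> applied degreewise; this is not the homological shift.\<close>

definition cshift :: "real \<Rightarrow> ('n::finite, 'k, 'v) pcomplex \<Rightarrow> ('n, 'k, 'v) pcomplex" where
  "cshift \<epsilon> X = \<lparr>ob = (\<lambda>i. pshift \<epsilon> (ob X i)), df = (\<lambda>i. pshift_map \<epsilon> (df X i))\<rparr>"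

lemma cshift_cshift: "cshift \<epsilon> (cshift \<delta> X) = cshift (\<epsilon> + \<delta>) X"
  by (simp add: cshift_def pshift_pshift pshift_map_def add.assoc vec_add)

text \<open>The endofunctor of \<open>K(Pers(\<real>\<^sup>n))\<close> induced by \<open>[\<epsilon>]\<close> on a morphism \<open>F : X \<rightarrow> Y\<close>.\<close>

definition K_shift ::
  "('k, 'r) ring_scheme \<Rightarrow> ('n::finite, 'k, 'v) pcomplex \<Rightarrow> ('n, 'k, 'w) pcomplex \<Rightarrow> real
     \<Rightarrow> ('n, 'v, 'w) pgraded_map set \<Rightarrow> ('n, 'v, 'w) pgraded_map set" where
  "K_shift K X Y \<epsilon> F =
     (\<Union>\<phi>\<in>F. K_class K (cshift \<epsilon> X) (cshift \<epsilon> Y) (\<lambda>i. pshift_map \<epsilon> (\<phi> i)))"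

definition K_smoothing ::
  "('k, 'r) ring_scheme \<Rightarrow> real \<Rightarrow> ('n::finite, 'k, 'v) pcomplex \<Rightarrow> ('n, 'v, 'v) pgraded_map set" where
  "K_smoothing K \<epsilon> X = K_class K X (cshift \<epsilon> X) (\<lambda>i. smoothing \<epsilon> (ob X i))"

definition K_interleaved ::
  "('k, 'r) ring_scheme \<Rightarrow> real \<Rightarrow> ('n::finite, 'k, 'v) pcomplex \<Rightarrow> ('n, 'k, 'w) pcomplex \<Rightarrow> bool" where
  "K_interleaved K \<epsilon> X Y \<longleftrightarrow>
     (\<exists>F\<in>K_hom K X (cshift \<epsilon> Y). \<exists>G\<in>K_hom K Y (cshift \<epsilon> X).
        K_comp K X (cshift \<epsilon> (cshift \<epsilon> X)) (K_shift K Y (cshift \<epsilon> X) \<epsilon> G) F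
          = K_smoothing K (2 * \<epsilon>) X \<and>
        K_comp K Y (cshift \<epsilon> (cshift \<epsilon> Y)) (K_shift K X (cshift \<epsilon> Y) \<epsilon> F) G
          = K_smoothing K (2 * \<epsilon>) Y)"

definition d_I_K ::
  "('k, 'r) ring_scheme \<Rightarrow> ('n::finite, 'k, 'v) pcomplex \<Rightarrow> ('n, 'k, 'w) pcomplex \<Rightarrow> ennreal" where
  "d_I_K K X Y = Inf (ennreal ` {\<epsilon>. 0 \<le> \<epsilon> \<and> K_interleaved K \<epsilon> X Y})"

section \<open>Cohomology\<close>

definition cocycles ::
  "('n::finite, 'k, 'v) pcomplex \<Rightarrow> int \<Rightarrow> real ^ 'n \<Rightarrow> 'v set" where
  "cocycles X j s = {x \<in> carrier (fib (ob X j) s). df X j s x = \<zero>\<^bsub>fib (ob X (j + 1)) s\<^esub>}"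

definition coboundaries ::
  "('n::finite, 'k, 'v) pcomplex \<Rightarrow> int \<Rightarrow> real ^ 'n \<Rightarrow> 'v set" where
  "coboundaries X j s = df X (j - 1) s ` carrier (fib (ob X (j - 1)) s)"

definition coh_class ::
  "('n::finite, 'k, 'v) pcomplex \<Rightarrow> int \<Rightarrow> real ^ 'n \<Rightarrow> 'v \<Rightarrow> 'v set" where
  "coh_class X j s x = coboundaries X j s +>\<^bsub>fib (ob X j) s\<^esub> x"

text \<open>
  \<open>H\<^sup>j(X)\<close> is computed pointwise as cocycles modulo coboundaries, its elements being cosets; the
  unions only express independence of representatives. The fields \<open>mult\<close> and \<open>one\<close>,
  inherited by the HOL-Algebra record of modules from rings, play no role.
\<close>

definition cohomology ::
  "('n::finite, 'k, 'v) pcomplex \<Rightarrow> int \<Rightarrow> ('n, 'k, 'v set) persmod" where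
  "cohomology X j =
     \<lparr>fib = (\<lambda>s. \<lparr>carrier = coh_class X j s ` cocycles X j s,
                  mult = undefined, one = undefined,
                  zero = coboundaries X j s,
                  add = (\<lambda>C D. C <+>\<^bsub>fib (ob X j) s\<^esub> D),
                  smult = (\<lambda>a C. \<Union>x\<in>C. coh_class X j s (a \<odot>\<^bsub>fib (ob X j) s\<^esub> x))\<rparr>),
      tr = (\<lambda>s t C. \<Union>x\<in>C. coh_class X j t (tr (ob X j) s t x))\<rparr>"

definition cohomology_map ::
  "('n::finite, 'k, 'w) pcomplex \<Rightarrow> int \<Rightarrow> ('n, 'v, 'w) pgraded_map \<Rightarrow> real ^ 'n \<Rightarrow> 'v set \<Rightarrow> 'w set" where
  "cohomology_map Y j \<phi> = (\<lambda>s C. \<Union>x\<in>C. coh_class Y j s (\<phi> j s x))"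

section \<open>Resolution functors\<close>

definition projective_resolution ::
  "('k, 'r) ring_scheme \<Rightarrow> ('n::finite, 'k, 'v) persmod \<Rightarrow> ('n, 'k, 'v) pcomplex
     \<Rightarrow> (real ^ 'n \<Rightarrow> 'v set \<Rightarrow> 'v) \<Rightarrow> bool" where
  "projective_resolution K M X \<rho> \<longleftrightarrow>
     cochain_complex K X \<and>
     (\<forall>i. pers_projective K (ob X i)) \<and>
     (\<forall>i>0. pers_zero (ob X i)) \<and>
     (\<forall>j. j \<noteq> 0 \<longrightarrow> pers_zero (cohomology X j)) \<and>
     pers_iso K (cohomology X 0) M \<rho>"

definition lifts ::
  "('k, 'r) ring_scheme
     \<Rightarrow> ('n::finite, 'k, 'v) pcomplex \<Rightarrow> (real ^ 'n \<Rightarrow> 'v set \<Rightarrow> 'v)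
     \<Rightarrow> ('n, 'k, 'v) pcomplex \<Rightarrow> (real ^ 'n \<Rightarrow> 'v set \<Rightarrow> 'v)
     \<Rightarrow> (real ^ 'n \<Rightarrow> 'v \<Rightarrow> 'v) \<Rightarrow> ('n, 'v, 'v) pgraded_map set" where
  "lifts K X \<rho> Y \<sigma> f = {\<phi> \<in> chain_maps K X Y.
     pers_eq (cohomology X 0) (pers_comp \<sigma> (cohomology_map Y 0 \<phi>)) (pers_comp f \<rho>)}"

text \<open>
  \<open>P\<close> is the object part and \<open>Pm M N f\<close> the value on a morphism \<open>f : M \<rightarrow> N\<close>;
  \<open>\<rho> M\<close> is the isomorphism of \<open>H\<^sup>0(P M)\<close> with \<open>M\<close> that gives meaning to ``lifting''.
\<close>

definition resolution_functor ::
  "('k, 'r) ring_scheme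
     \<Rightarrow> (('n::finite, 'k, 'v) persmod \<Rightarrow> ('n, 'k, 'v) pcomplex)
     \<Rightarrow> (('n, 'k, 'v) persmod \<Rightarrow> real ^ 'n \<Rightarrow> 'v set \<Rightarrow> 'v)
     \<Rightarrow> (('n, 'k, 'v) persmod \<Rightarrow> ('n, 'k, 'v) persmod \<Rightarrow> (real ^ 'n \<Rightarrow> 'v \<Rightarrow> 'v)
          \<Rightarrow> ('n, 'v, 'v) pgraded_map set)
     \<Rightarrow> bool" where
  "resolution_functor K P \<rho> Pm \<longleftrightarrow>
     (\<forall>M. persistence_module K M \<longrightarrow> projective_resolution K M (P M) (\<rho> M)) \<and>
     (\<forall>M N f. persistence_module K M \<longrightarrow> persistence_module K N \<longrightarrow> f \<in> pers_hom K M N \<longrightarrow>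
        (\<exists>\<phi>\<in>lifts K (P M) (\<rho> M) (P N) (\<rho> N) f. Pm M N f = K_class K (P M) (P N) \<phi>))"

end

theory Submission
  imports Defs
begin

text \<open>
  The two sets of interleaving parameters coincide. The functor \<open>[\<epsilon>]\<close> is exact, so \<open>P(N)[\<epsilon>]\<close> is
  still a resolution of \<open>N[\<epsilon>]\<close>, though its terms are not assumed projective. The comparison theorem
  needs projectivity in the source and acyclicity in the target only, so morphisms \<open>M \<rightarrow> N[\<epsilon>]\<close> lift
  to \<open>P(M) \<rightarrow> P(N)[\<epsilon>]\<close> uniquely up to homotopy; as the smoothing map of \<open>P(M)\<close> lifts that of \<open>M\<close>,
  interleavings lift to interleavings. Conversely, \<open>H\<^sup>0\<close> commutes with \<open>[\<epsilon>]\<close> and with smoothings, and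
  so carries interleavings of the resolutions to interleavings of \<open>M\<close> and \<open>N\<close>.
\<close>

section \<open>Linear maps and morphisms of persistence modules\<close>

text \<open>Two features of the setting shape the argument. The fibres of \<open>cohomology\<close>
  consist of cosets and have element type \<open>'v set\<close>, whereas
  \<open>pers_projective\<close> tests lifting only against persistence modules with elements in
  \<open>'v\<close>. The isomorphism \<open>\<rho>\<close> is therefore composed with the class map
  to give an augmentation from \<open>ob X 0\<close> to \<open>M\<close>, and every lifting problem
  is posed among modules over \<open>'v\<close>. Being a resolution then becomes pointwise exactness
  of the augmented complex, a condition that translation of the index point preserves. Moreover, the
  morphisms in the homotopy interleaving equations are sets of chain maps, and their composition and
  shift are unions over all representatives. An equation of classes turns into a homotopy only once
  homotopy is known to be an equivalence relation compatible with both operations. The two sides of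
  such an equation have a common target because shifting twice by \<open>\<epsilon>\<close> and once
  by \<open>2 * \<epsilon>\<close> give equal complexes, not merely isomorphic ones.\<close>

lemma abelian_group_diff_eq_iff:
  assumes "abelian_group V" "x \<in> carrier V" "y \<in> carrier V" "z \<in> carrier V"
  shows "x \<ominus>\<^bsub>V\<^esub> y = z \<longleftrightarrow> x = y \<oplus>\<^bsub>V\<^esub> z"
proof -
  interpret abelian_group V by fact
  show ?thesis
    using assms(2-) add.inv_solve_right[of z x y] by (auto simp: a_minus_def a_comm)
qed

lemma linear_maps_simps:
  assumes "f \<in> linear_maps K V W"
  shows linear_maps_closed: "\<And>x. x \<in> carrier V \<Longrightarrow> f x \<in> carrier W"
    and linear_maps_add: "\<And>x y. \<lbrakk>x \<in> carrier V; y \<in> carrier V\<rbrakk> \<Longrightarrow> f (x \<oplus>\<^bsub>V\<^esub> y) = f x \<oplus>\<^bsub>W\<^esub> f y"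
    and linear_maps_smult: "\<And>a x. \<lbrakk>a \<in> carrier K; x \<in> carrier V\<rbrakk> \<Longrightarrow> f (a \<odot>\<^bsub>V\<^esub> x) = a \<odot>\<^bsub>W\<^esub> f x"
  using assms by (auto simp: linear_maps_def)

lemma linear_mapsI:
  assumes "\<And>x. x \<in> carrier V \<Longrightarrow> f x \<in> carrier W"
    and "\<And>x y. \<lbrakk>x \<in> carrier V; y \<in> carrier V\<rbrakk> \<Longrightarrow> f (x \<oplus>\<^bsub>V\<^esub> y) = f x \<oplus>\<^bsub>W\<^esub> f y"
    and "\<And>a x. \<lbrakk>a \<in> carrier K; x \<in> carrier V\<rbrakk> \<Longrightarrow> f (a \<odot>\<^bsub>V\<^esub> x) = a \<odot>\<^bsub>W\<^esub> f x"
  shows "f \<in> linear_maps K V W"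
  using assms by (auto simp: linear_maps_def)

lemma linear_maps_zero:
  assumes "Module.module K V" "Module.module K W" "f \<in> linear_maps K V W"
  shows "f \<zero>\<^bsub>V\<^esub> = \<zero>\<^bsub>W\<^esub>"
proof -
  interpret V: Module.module K V by fact
  interpret W: Module.module K W by fact
  have "f \<zero>\<^bsub>V\<^esub> \<oplus>\<^bsub>W\<^esub> f \<zero>\<^bsub>V\<^esub> = f \<zero>\<^bsub>V\<^esub>"
    using linear_maps_add[OF assms(3), of "\<zero>\<^bsub>V\<^esub>" "\<zero>\<^bsub>V\<^esub>"] by simp
  then show ?thesis
    using linear_maps_closed[OF assms(3)] W.M.add.r_cancel_one by blast
qed

lemma linear_maps_minus:
  assumes "Module.module K V" "Module.module K W" "f \<in> linear_maps K V W" "x \<in> carrier V"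
  shows "f (\<ominus>\<^bsub>V\<^esub> x) = \<ominus>\<^bsub>W\<^esub> f x"
proof -
  interpret V: Module.module K V by fact
  interpret W: Module.module K W by fact
  have "f (\<ominus>\<^bsub>V\<^esub> x) \<oplus>\<^bsub>W\<^esub> f x = \<zero>\<^bsub>W\<^esub>"
    using linear_maps_add[OF assms(3), of "\<ominus>\<^bsub>V\<^esub> x" x] linear_maps_zero[OF assms(1-3)] assms(4)
    by (simp add: V.l_neg)
  then show ?thesis
    using linear_maps_closed[OF assms(3)] assms(4) W.minus_equality by (metis V.a_inv_closed)
qed

lemma linear_maps_diff:
  assumes "Module.module K V" "Module.module K W" "f \<in> linear_maps K V W"
    "x \<in> carrier V" "y \<in> carrier V"
  shows "f (x \<ominus>\<^bsub>V\<^esub> y) = f x \<ominus>\<^bsub>W\<^esub> f y"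
proof -
  interpret V: Module.module K V by fact
  show ?thesis
    using assms by (simp add: a_minus_def linear_maps_add[OF assms(3)] linear_maps_minus)
qed

lemma linear_maps_comp:
  assumes "f \<in> linear_maps K U V" "g \<in> linear_maps K V W"
  shows "(\<lambda>x. g (f x)) \<in> linear_maps K U W"
  by (rule linear_mapsI) (simp_all add: linear_maps_simps[OF assms(1)] linear_maps_simps[OF assms(2)])

lemma linear_maps_pointwise_add:
  assumes "Module.module K W" "f \<in> linear_maps K V W" "g \<in> linear_maps K V W"
  shows "(\<lambda>x. f x \<oplus>\<^bsub>W\<^esub> g x) \<in> linear_maps K V W"
proof -
  interpret W: Module.module K W by fact
  note [simp] = linear_maps_simps[OF assms(2)] linear_maps_simps[OF assms(3)]
  show ?thesis
    by (rule linear_mapsI) (simp_all add: W.a_ac W.smult_r_distr)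
qed

lemma linear_maps_pointwise_minus:
  assumes "Module.module K W" "f \<in> linear_maps K V W"
  shows "(\<lambda>x. \<ominus>\<^bsub>W\<^esub> f x) \<in> linear_maps K V W"
proof -
  interpret W: Module.module K W by fact
  note [simp] = linear_maps_simps[OF assms(2)]
  show ?thesis
    by (rule linear_mapsI) (simp_all add: W.minus_add W.smult_r_minus)
qed

lemma linear_maps_const_zero:
  assumes "Module.module K W"
  shows "(\<lambda>x. \<zero>\<^bsub>W\<^esub>) \<in> linear_maps K V W"
proof -
  interpret W: Module.module K W by fact
  show ?thesis
    by (rule linear_mapsI) simp_all
qed

section \<open>Morphisms as natural families of linear maps\<close>

lemma pers_homI:
  assumes "\<And>s. f s \<in> linear_maps K (fib M s) (fib N s)"
    and "\<And>s t x. \<lbrakk>s \<le> t; x \<in> carrier (fib M s)\<rbrakk> \<Longrightarrow> f t (tr M s t x) = tr N s t (f s x)"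
  shows "f \<in> pers_hom K M N"
  using assms by (simp add: pers_hom_def)

lemma pers_hom_linear: "f \<in> pers_hom K M N \<Longrightarrow> f s \<in> linear_maps K (fib M s) (fib N s)"
  by (simp add: pers_hom_def)

lemma pers_hom_tr:
  "\<lbrakk>f \<in> pers_hom K M N; s \<le> t; x \<in> carrier (fib M s)\<rbrakk> \<Longrightarrow> f t (tr M s t x) = tr N s t (f s x)"
  by (simp add: pers_hom_def)

lemma persistence_module_fib: "persistence_module K M \<Longrightarrow> Module.module K (fib M s)"
  by (simp add: persistence_module_def)

lemma persistence_module_tr:
  "\<lbrakk>persistence_module K M; s \<le> t\<rbrakk> \<Longrightarrow> tr M s t \<in> linear_maps K (fib M s) (fib M t)"
  by (simp add: persistence_module_def)

lemma persistence_module_tr_tr: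
  "\<lbrakk>persistence_module K M; s \<le> t; t \<le> u; x \<in> carrier (fib M s)\<rbrakk>
    \<Longrightarrow> tr M t u (tr M s t x) = tr M s u x"
  by (simp add: persistence_module_def)

lemma persistence_module_abelian_group: "persistence_module K M \<Longrightarrow> abelian_group (fib M s)"
  using Module.module.axioms(2) persistence_module_fib by blast

lemmas pers_hom_closed = linear_maps_closed[OF pers_hom_linear]
lemmas pers_hom_add = linear_maps_add[OF pers_hom_linear]
lemmas pers_hom_smult = linear_maps_smult[OF pers_hom_linear]

lemma pers_hom_zero:
  assumes "persistence_module K M" "persistence_module K N" "f \<in> pers_hom K M N"
  shows "f s \<zero>\<^bsub>fib M s\<^esub> = \<zero>\<^bsub>fib N s\<^esub>"
  using assms by (intro linear_maps_zero[OF _ _ pers_hom_linear] persistence_module_fib)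

lemma pers_hom_diff:
  assumes "persistence_module K M" "persistence_module K N" "f \<in> pers_hom K M N"
    "x \<in> carrier (fib M s)" "y \<in> carrier (fib M s)"
  shows "f s (x \<ominus>\<^bsub>fib M s\<^esub> y) = f s x \<ominus>\<^bsub>fib N s\<^esub> f s y"
  using assms by (intro linear_maps_diff[OF _ _ pers_hom_linear] persistence_module_fib)

lemma pers_hom_comp:
  assumes "f \<in> pers_hom K L M" "g \<in> pers_hom K M N"
  shows "(\<lambda>s x. g s (f s x)) \<in> pers_hom K L N"
proof (rule pers_homI)
  show "(\<lambda>x. g s (f s x)) \<in> linear_maps K (fib L s) (fib N s)" for s
    using linear_maps_comp pers_hom_linear assms by metis
qed (simp add: pers_hom_tr[OF assms(1)] pers_hom_tr[OF assms(2)] pers_hom_closed[OF assms(1)])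

lemma pers_hom_pointwise_add:
  assumes N: "persistence_module K N" and f: "f \<in> pers_hom K M N" and g: "g \<in> pers_hom K M N"
  shows "(\<lambda>s x. f s x \<oplus>\<^bsub>fib N s\<^esub> g s x) \<in> pers_hom K M N"
proof (rule pers_homI)
  show "(\<lambda>x. f s x \<oplus>\<^bsub>fib N s\<^esub> g s x) \<in> linear_maps K (fib M s) (fib N s)" for s
    using assms by (intro linear_maps_pointwise_add persistence_module_fib pers_hom_linear)
qed (simp add: pers_hom_tr[OF f] pers_hom_tr[OF g] linear_maps_add[OF persistence_module_tr[OF N]]
    pers_hom_closed[OF f] pers_hom_closed[OF g])

lemma pers_hom_pointwise_minus:
  assumes N: "persistence_module K N" and f: "f \<in> pers_hom K M N"
  shows "(\<lambda>s x. \<ominus>\<^bsub>fib N s\<^esub> f s x) \<in> pers_hom K M N"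
proof (rule pers_homI)
  show "(\<lambda>x. \<ominus>\<^bsub>fib N s\<^esub> f s x) \<in> linear_maps K (fib M s) (fib N s)" for s
    using assms by (intro linear_maps_pointwise_minus persistence_module_fib pers_hom_linear)
qed (simp add: pers_hom_tr[OF f] pers_hom_closed[OF f] linear_maps_minus[OF
      persistence_module_fib[OF N] persistence_module_fib[OF N] persistence_module_tr[OF N]])

lemma pers_hom_pointwise_diff:
  assumes "persistence_module K N" "f \<in> pers_hom K M N" "g \<in> pers_hom K M N"
  shows "(\<lambda>s x. f s x \<ominus>\<^bsub>fib N s\<^esub> g s x) \<in> pers_hom K M N"
  unfolding a_minus_def
  using assms by (intro pers_hom_pointwise_add pers_hom_pointwise_minus)

lemma pers_hom_const_zero:
  assumes N: "persistence_module K N"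
  shows "(\<lambda>s x. \<zero>\<^bsub>fib N s\<^esub>) \<in> pers_hom K M N"
proof (rule pers_homI)
  show "(\<lambda>x. \<zero>\<^bsub>fib N s\<^esub>) \<in> linear_maps K (fib M s) (fib N s)" for s
    using assms by (intro linear_maps_const_zero persistence_module_fib)
qed (simp add: linear_maps_zero[OF
      persistence_module_fib[OF N] persistence_module_fib[OF N] persistence_module_tr[OF N]])

section \<open>Images and lifting against them\<close>

text \<open>Serves twice: for the image through which projectives lift, and for coboundaries, which
  are the image of the incoming differential.\<close>

lemma pers_hom_image_submodule:
  assumes A: "persistence_module K A" and B: "persistence_module K B" and d: "d \<in> pers_hom K A B"
  shows "submodule (d s ` carrier (fib A s)) K (fib B s)"
proof -
  interpret A: Module.module K "fib A s" using persistence_module_fib[OF A] .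
  interpret B: Module.module K "fib B s" using persistence_module_fib[OF B] .
  show ?thesis
  proof (rule B.submoduleI)
    show "\<zero>\<^bsub>fib B s\<^esub> \<in> d s ` carrier (fib A s)"
      using pers_hom_zero[OF A B d] A.zero_closed imageI by metis
    show "\<ominus>\<^bsub>fib B s\<^esub> y \<in> d s ` carrier (fib A s)" if "y \<in> d s ` carrier (fib A s)" for y
      using that linear_maps_minus[OF persistence_module_fib[OF A] persistence_module_fib[OF B]
          pers_hom_linear[OF d], symmetric] by auto
    show "x \<oplus>\<^bsub>fib B s\<^esub> y \<in> d s ` carrier (fib A s)"
      if "x \<in> d s ` carrier (fib A s)" "y \<in> d s ` carrier (fib A s)" for x y
      using that pers_hom_add[OF d, symmetric] by auto
    show "a \<odot>\<^bsub>fib B s\<^esub> y \<in> d s ` carrier (fib A s)"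
      if "a \<in> carrier K" "y \<in> d s ` carrier (fib A s)" for a y
      using that pers_hom_smult[OF d, symmetric] by auto
  qed (use pers_hom_closed[OF d] in auto)
qed

text \<open>
  The lift is taken against \<open>d\<close> corestricted to its image, which is pointwise surjective and
  hence epi; that epimorphisms are pointwise surjective is never needed.
\<close>

lemma projective_lift_through_image:
  fixes Q A B :: "('n::finite, 'k, 'v) persmod"
  assumes Q: "pers_projective K Q" and A: "persistence_module K A" and B: "persistence_module K B"
    and d: "d \<in> pers_hom K A B" and f: "f \<in> pers_hom K Q B"
    and im: "\<And>s x. x \<in> carrier (fib Q s) \<Longrightarrow> f s x \<in> d s ` carrier (fib A s)"
  obtains g where "g \<in> pers_hom K Q A"
    and "\<And>s x. x \<in> carrier (fib Q s) \<Longrightarrow> d s (g s x) = f s x"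
proof -
  \<comment> \<open>The image is cut out of \<open>B\<close>, keeping its operations and transition
    maps, rather than formed as a quotient of \<open>A\<close>. Its elements thus stay in
    \<open>'v\<close>, the only element type for which projectivity of \<open>Q\<close> provides
    lifts.\<close>
  define I :: "('n, 'k, 'v) persmod" where
    "I = \<lparr>fib = (\<lambda>s. (fib B s)\<lparr>carrier := d s ` carrier (fib A s)\<rparr>), tr = tr B\<rparr>"
  have sub: "x \<in> carrier (fib B s)" if "x \<in> carrier (fib I s)" for s x
    using that pers_hom_closed[OF d] by (auto simp: I_def)
  have trI: "tr I s t x \<in> carrier (fib I t)" if "s \<le> t" "x \<in> carrier (fib I s)" for s t x
    using that pers_hom_tr[OF d, symmetric] linear_maps_closed[OF persistence_module_tr[OF A]]
    by (auto simp: I_def)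
  have I: "persistence_module K I"
    unfolding persistence_module_def
  proof (intro conjI allI impI ballI)
    show "Module.module K (fib I s)" for s
      using submodule.submodule_is_module[OF pers_hom_image_submodule[OF A B d]
          persistence_module_fib[OF B]] by (simp add: I_def)
    show "tr I s t \<in> linear_maps K (fib I s) (fib I t)" if "s \<le> t" for s t
      using trI[OF that] sub linear_maps_simps[OF persistence_module_tr[OF B that]]
      by (intro linear_mapsI) (auto simp: I_def)
  qed (use B sub in \<open>auto simp: I_def persistence_module_def\<close>)
  \<comment> \<open>A morphism is a bare family of functions, so \<open>d\<close> and
    \<open>f\<close> themselves are morphisms into \<open>I\<close> once their values are known to
    lie in the image.\<close>
  have dI: "d \<in> pers_hom K A I"
    using d by (auto simp: I_def pers_hom_def linear_maps_def)
  have fI: "f \<in> pers_hom K Q I"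
    using f im by (auto simp: I_def pers_hom_def linear_maps_def)
  have "pers_epi K A I d"
    unfolding pers_epi_def using dI by (auto simp: I_def pers_eq_def pers_comp_def)
  then obtain g where g: "g \<in> pers_hom K Q A" and "pers_eq Q (pers_comp d g) f"
    using Q A I fI unfolding pers_projective_def by blast
  then show thesis
    by (intro that[OF g]) (simp add: pers_eq_def pers_comp_def)
qed

section \<open>Shifts\<close>

lemma pshift_simps [simp]:
  "fib (pshift \<epsilon> M) s = fib M (s + vec \<epsilon>)"
  "tr (pshift \<epsilon> M) s t = tr M (s + vec \<epsilon>) (t + vec \<epsilon>)"
  by (simp_all add: pshift_def)

lemma persistence_module_pshift: "persistence_module K M \<Longrightarrow> persistence_module K (pshift \<epsilon> M)"
  by (auto simp: persistence_module_def)

lemma pers_hom_pshift: "f \<in> pers_hom K M N \<Longrightarrow> pshift_map \<epsilon> f \<in> pers_hom K (pshift \<epsilon> M) (pshift \<epsilon> N)"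
  by (auto simp: pers_hom_def pshift_map_def)

lemma zero_le_vec: "0 \<le> \<epsilon> \<Longrightarrow> 0 \<le> (vec \<epsilon> :: real ^ 'n)"
  by (simp add: less_eq_vec_def)

text \<open>Both ways round the naturality square are the transition map from \<open>s\<close> to
  \<open>t + vec \<epsilon>\<close>. Nonnegativity of \<open>\<epsilon>\<close> gives
  \<open>s \<le> s + vec \<epsilon>\<close>, where transition maps are meaningful.\<close>

lemma pers_hom_smoothing:
  assumes "persistence_module K M" "0 \<le> \<epsilon>"
  shows "smoothing \<epsilon> M \<in> pers_hom K M (pshift \<epsilon> M)"
proof (rule pers_homI)
  show "smoothing \<epsilon> M s \<in> linear_maps K (fib M s) (fib (pshift \<epsilon> M) s)" for s
    using assms by (simp add: smoothing_def persistence_module_tr zero_le_vec)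
  show "smoothing \<epsilon> M t (tr M s t x) = tr (pshift \<epsilon> M) s t (smoothing \<epsilon> M s x)"
    if "s \<le> t" "x \<in> carrier (fib M s)" for s t x
    using that assms by (simp add: smoothing_def persistence_module_tr_tr zero_le_vec)
qed

section \<open>Complexes and chain maps under shift\<close>

lemma cshift_simps [simp]:
  "ob (cshift \<epsilon> X) i = pshift \<epsilon> (ob X i)"
  "df (cshift \<epsilon> X) i = pshift_map \<epsilon> (df X i)"
  by (simp_all add: cshift_def)

lemma cochain_complex_ob: "cochain_complex K X \<Longrightarrow> persistence_module K (ob X i)"
  by (simp add: cochain_complex_def)

lemma cochain_complex_df: "cochain_complex K X \<Longrightarrow> df X i \<in> pers_hom K (ob X i) (ob X (i + 1))"
  by (simp add: cochain_complex_def)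

text \<open>The target supplied by the definition is literally \<open>ob X (i - 1 + 1)\<close>.
  Rewriting it to \<open>ob X i\<close> lets rules about the differential entering degree
  \<open>i\<close> match.\<close>

lemma cochain_complex_df_pred: "cochain_complex K X \<Longrightarrow> df X (i - 1) \<in> pers_hom K (ob X (i - 1)) (ob X i)"
  using cochain_complex_df[of K X "i - 1"] by simp

lemma cochain_complex_df_df:
  "\<lbrakk>cochain_complex K X; x \<in> carrier (fib (ob X i) s)\<rbrakk>
    \<Longrightarrow> df X (i + 1) s (df X i s x) = \<zero>\<^bsub>fib (ob X (i + 1 + 1)) s\<^esub>"
  by (simp add: cochain_complex_def)

lemma cochain_complex_df_df_pred:
  "\<lbrakk>cochain_complex K X; x \<in> carrier (fib (ob X (i - 1)) s)\<rbrakk>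
    \<Longrightarrow> df X i s (df X (i - 1) s x) = \<zero>\<^bsub>fib (ob X (i + 1)) s\<^esub>"
  using cochain_complex_df_df[of K X x "i - 1"] by simp

lemma cochain_complex_cshift: "cochain_complex K X \<Longrightarrow> cochain_complex K (cshift \<epsilon> X)"
  unfolding cochain_complex_def
  by (simp add: persistence_module_pshift pers_hom_pshift) (simp add: pshift_map_def)

lemma chain_maps_hom: "\<phi> \<in> chain_maps K X Y \<Longrightarrow> \<phi> i \<in> pers_hom K (ob X i) (ob Y i)"
  by (simp add: chain_maps_def)

lemma chain_maps_df:
  "\<lbrakk>\<phi> \<in> chain_maps K X Y; x \<in> carrier (fib (ob X i) s)\<rbrakk>
    \<Longrightarrow> \<phi> (i + 1) s (df X i s x) = df Y i s (\<phi> i s x)"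
  by (simp add: chain_maps_def pers_eq_def pers_comp_def)

lemma chain_maps_df_pred:
  "\<lbrakk>\<phi> \<in> chain_maps K X Y; x \<in> carrier (fib (ob X (i - 1)) s)\<rbrakk>
    \<Longrightarrow> \<phi> i s (df X (i - 1) s x) = df Y (i - 1) s (\<phi> (i - 1) s x)"
  using chain_maps_df[of \<phi> K X Y x "i - 1"] by simp

lemma chain_maps_comp:
  assumes \<phi>: "\<phi> \<in> chain_maps K X Y" and \<gamma>: "\<gamma> \<in> chain_maps K Y Z"
  shows "(\<lambda>i. pers_comp (\<gamma> i) (\<phi> i)) \<in> chain_maps K X Z"
  using pers_hom_comp[OF chain_maps_hom[OF \<phi>] chain_maps_hom[OF \<gamma>]]
    chain_maps_df[OF \<phi>] chain_maps_df[OF \<gamma>] pers_hom_closed[OF chain_maps_hom[OF \<phi>]]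
  by (auto simp: chain_maps_def pers_eq_def pers_comp_def)

lemma chain_maps_cshift:
  assumes "\<phi> \<in> chain_maps K X Y"
  shows "(\<lambda>i. pshift_map \<epsilon> (\<phi> i)) \<in> chain_maps K (cshift \<epsilon> X) (cshift \<epsilon> Y)"
  using assms unfolding chain_maps_def
  by (simp add: pers_hom_pshift) (simp add: pers_eq_def pers_comp_def pshift_map_def)

text \<open>The components of a smoothing are transition maps, so commutation with the differential
  is naturality of \<open>df X i\<close> along \<open>s \<le> s + vec \<epsilon>\<close>.\<close>

lemma chain_maps_smoothing:
  assumes X: "cochain_complex K X" and "0 \<le> \<epsilon>"
  shows "(\<lambda>i. smoothing \<epsilon> (ob X i)) \<in> chain_maps K X (cshift \<epsilon> X)"
  using pers_hom_smoothing[OF cochain_complex_ob[OF X] assms(2)]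
  by (simp add: chain_maps_def pers_eq_def pers_comp_def pshift_map_def)
    (simp add: smoothing_def pers_hom_tr[OF cochain_complex_df[OF X]] zero_le_vec assms(2))

section \<open>Homotopies\<close>

text \<open>Homotopy is defined by a difference. In additive form \<open>\<phi>\<close> can be
  replaced outright by its expression in \<open>\<psi>\<close> and \<open>h\<close>, after which the
  commutative group laws finish. The two forms agree because all the terms lie in the
  carrier.\<close>

lemma homotopy_rel_iff:
  assumes X: "cochain_complex K X" and Y: "cochain_complex K Y"
  shows "(\<phi>, \<psi>) \<in> homotopy_rel K X Y \<longleftrightarrow> \<phi> \<in> chain_maps K X Y \<and> \<psi> \<in> chain_maps K X Y \<and>
     (\<exists>h. (\<forall>i. h i \<in> pers_hom K (ob X i) (ob Y (i - 1))) \<and>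
        (\<forall>i s. \<forall>x\<in>carrier (fib (ob X i) s). \<phi> i s x =
           \<psi> i s x \<oplus>\<^bsub>fib (ob Y i) s\<^esub> (df Y (i - 1) s (h i s x) \<oplus>\<^bsub>fib (ob Y i) s\<^esub> h (i + 1) s (df X i s x))))"
proof -
  have "\<phi> i s x \<ominus>\<^bsub>fib (ob Y i) s\<^esub> \<psi> i s x =
        df Y (i - 1) s (h i s x) \<oplus>\<^bsub>fib (ob Y i) s\<^esub> h (i + 1) s (df X i s x) \<longleftrightarrow>
      \<phi> i s x = \<psi> i s x \<oplus>\<^bsub>fib (ob Y i) s\<^esub>
        (df Y (i - 1) s (h i s x) \<oplus>\<^bsub>fib (ob Y i) s\<^esub> h (i + 1) s (df X i s x))"
    if "\<phi> \<in> chain_maps K X Y" "\<psi> \<in> chain_maps K X Y"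
      and h: "\<And>i. h i \<in> pers_hom K (ob X i) (ob Y (i - 1))"
      and x: "x \<in> carrier (fib (ob X i) s)" for h i s x
  proof -
    have "abelian_group (fib (ob Y i) s)"
      using Y cochain_complex_ob persistence_module_abelian_group by blast
    moreover have "h (i + 1) \<in> pers_hom K (ob X (i + 1)) (ob Y i)"
      using h[of "i + 1"] by simp
    moreover have "df Y (i - 1) s (h i s x) \<in> carrier (fib (ob Y i) s)"
      using pers_hom_closed[OF cochain_complex_df_pred[OF Y]] pers_hom_closed[OF h x] by blast
    ultimately show ?thesis
      using that pers_hom_closed[OF chain_maps_hom] pers_hom_closed[OF cochain_complex_df[OF X] x]
      by (intro abelian_group_diff_eq_iff) (auto intro: abelian_groupE(1) pers_hom_closed)
  qed
  then have "(\<exists>h. (\<forall>i. h i \<in> pers_hom K (ob X i) (ob Y (i - 1))) \<and>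
        (\<forall>i s. \<forall>x\<in>carrier (fib (ob X i) s). \<phi> i s x \<ominus>\<^bsub>fib (ob Y i) s\<^esub> \<psi> i s x =
           df Y (i - 1) s (h i s x) \<oplus>\<^bsub>fib (ob Y i) s\<^esub> h (i + 1) s (df X i s x))) \<longleftrightarrow>
      (\<exists>h. (\<forall>i. h i \<in> pers_hom K (ob X i) (ob Y (i - 1))) \<and>
        (\<forall>i s. \<forall>x\<in>carrier (fib (ob X i) s). \<phi> i s x = \<psi> i s x \<oplus>\<^bsub>fib (ob Y i) s\<^esub>
           (df Y (i - 1) s (h i s x) \<oplus>\<^bsub>fib (ob Y i) s\<^esub> h (i + 1) s (df X i s x))))"
    if "\<phi> \<in> chain_maps K X Y" "\<psi> \<in> chain_maps K X Y"
    using that by (intro arg_cong[of _ _ Ex] ext conj_cong refl all_cong1 ball_cong) blast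
  then show ?thesis
    unfolding homotopy_rel_def mem_Collect_eq case_prod_conv by (intro conj_cong refl)
qed

text \<open>The second clause is the first in degree \<open>i + 1\<close> with
  \<open>i + 1 - 1\<close> simplified: it shows \<open>h (i + 1)\<close> landing in degree
  \<open>i\<close>, where the homotopy formula adds it.\<close>

lemma homotopyE:
  assumes "cochain_complex K X" "cochain_complex K Y" "(\<phi>, \<psi>) \<in> homotopy_rel K X Y"
  obtains h where "\<And>i. h i \<in> pers_hom K (ob X i) (ob Y (i - 1))"
    and "\<And>i. h (i + 1) \<in> pers_hom K (ob X (i + 1)) (ob Y i)"
    and "\<And>i s x. x \<in> carrier (fib (ob X i) s) \<Longrightarrow> \<phi> i s x =
        \<psi> i s x \<oplus>\<^bsub>fib (ob Y i) s\<^esub> (df Y (i - 1) s (h i s x) \<oplus>\<^bsub>fib (ob Y i) s\<^esub> h (i + 1) s (df X i s x))"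
proof -
  obtain h where h: "\<And>i. h i \<in> pers_hom K (ob X i) (ob Y (i - 1))"
    and eq: "\<And>i s x. x \<in> carrier (fib (ob X i) s) \<Longrightarrow> \<phi> i s x =
        \<psi> i s x \<oplus>\<^bsub>fib (ob Y i) s\<^esub> (df Y (i - 1) s (h i s x) \<oplus>\<^bsub>fib (ob Y i) s\<^esub> h (i + 1) s (df X i s x))"
    using assms(3) unfolding homotopy_rel_iff[OF assms(1,2)] by blast
  have "h (i + 1) \<in> pers_hom K (ob X (i + 1)) (ob Y i)" for i
    using h[of "i + 1"] by simp
  from that[OF h this eq] show thesis .
qed

lemma homotopyI:
  assumes "cochain_complex K X" "cochain_complex K Y" "\<phi> \<in> chain_maps K X Y" "\<psi> \<in> chain_maps K X Y"
    and "\<And>i. h i \<in> pers_hom K (ob X i) (ob Y (i - 1))"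
    and "\<And>i s x. x \<in> carrier (fib (ob X i) s) \<Longrightarrow> \<phi> i s x =
        \<psi> i s x \<oplus>\<^bsub>fib (ob Y i) s\<^esub> (df Y (i - 1) s (h i s x) \<oplus>\<^bsub>fib (ob Y i) s\<^esub> h (i + 1) s (df X i s x))"
  shows "(\<phi>, \<psi>) \<in> homotopy_rel K X Y"
  unfolding homotopy_rel_iff[OF assms(1,2)] using assms(3-) by blast

lemma homotopy_rel_chain_maps:
  assumes "(\<phi>, \<psi>) \<in> homotopy_rel K X Y"
  shows "\<phi> \<in> chain_maps K X Y" "\<psi> \<in> chain_maps K X Y"
  using assms by (auto simp: homotopy_rel_def)

section \<open>Homotopy as an equivalence relation\<close>

lemma homotopy_refl:
  assumes X: "cochain_complex K X" and Y: "cochain_complex K Y" and \<phi>: "\<phi> \<in> chain_maps K X Y"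
  shows "(\<phi>, \<phi>) \<in> homotopy_rel K X Y"
proof (rule homotopyI[OF X Y \<phi> \<phi>])
  show "(\<lambda>s x. \<zero>\<^bsub>fib (ob Y (i - 1)) s\<^esub>) \<in> pers_hom K (ob X i) (ob Y (i - 1))" for i
    using Y by (intro pers_hom_const_zero cochain_complex_ob)
  fix i s x assume x: "x \<in> carrier (fib (ob X i) s)"
  interpret Y: abelian_group "fib (ob Y i) s"
    using Y cochain_complex_ob persistence_module_abelian_group by blast
  show "\<phi> i s x = \<phi> i s x \<oplus>\<^bsub>fib (ob Y i) s\<^esub>
      (df Y (i - 1) s \<zero>\<^bsub>fib (ob Y (i - 1)) s\<^esub> \<oplus>\<^bsub>fib (ob Y i) s\<^esub> \<zero>\<^bsub>fib (ob Y (i + 1 - 1)) s\<^esub>)"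
    using pers_hom_closed[OF chain_maps_hom[OF \<phi>] x]
    by (simp add: pers_hom_zero[OF cochain_complex_ob[OF Y] cochain_complex_ob[OF Y]
          cochain_complex_df_pred[OF Y]])
qed

text \<open>The negated homotopy works, since the differential is linear and lets the sign pass
  through.\<close>

lemma homotopy_sym:
  assumes X: "cochain_complex K X" and Y: "cochain_complex K Y"
    and hom: "(\<phi>, \<psi>) \<in> homotopy_rel K X Y"
  shows "(\<psi>, \<phi>) \<in> homotopy_rel K X Y"
proof -
  note c = homotopy_rel_chain_maps[OF hom]
  obtain h where h: "\<And>i. h i \<in> pers_hom K (ob X i) (ob Y (i - 1))"
      "\<And>i. h (i + 1) \<in> pers_hom K (ob X (i + 1)) (ob Y i)"
    and eq: "\<And>i s x. x \<in> carrier (fib (ob X i) s) \<Longrightarrow> \<phi> i s x =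
        \<psi> i s x \<oplus>\<^bsub>fib (ob Y i) s\<^esub> (df Y (i - 1) s (h i s x) \<oplus>\<^bsub>fib (ob Y i) s\<^esub> h (i + 1) s (df X i s x))"
    by (rule homotopyE[OF X Y hom]) (rule that)
  show ?thesis
  proof (rule homotopyI[OF X Y c(2) c(1)])
    show "(\<lambda>s x. \<ominus>\<^bsub>fib (ob Y (i - 1)) s\<^esub> h i s x) \<in> pers_hom K (ob X i) (ob Y (i - 1))" for i
      using Y h by (intro pers_hom_pointwise_minus cochain_complex_ob)
    fix i s x assume x: "x \<in> carrier (fib (ob X i) s)"
    interpret Y: abelian_group "fib (ob Y i) s"
      using Y cochain_complex_ob persistence_module_abelian_group by blast
    have cl: "\<psi> i s x \<in> carrier (fib (ob Y i) s)" "df Y (i - 1) s (h i s x) \<in> carrier (fib (ob Y i) s)"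
       "h (i + 1) s (df X i s x) \<in> carrier (fib (ob Y i) s)"
      using x h X Y c chain_maps_hom cochain_complex_df cochain_complex_df_pred
      by (meson pers_hom_closed)+
    have "df Y (i - 1) s (\<ominus>\<^bsub>fib (ob Y (i - 1)) s\<^esub> h i s x) = \<ominus>\<^bsub>fib (ob Y i) s\<^esub> df Y (i - 1) s (h i s x)"
      by (rule linear_maps_minus[OF _ _ pers_hom_linear[OF cochain_complex_df_pred[OF Y]]])
        (use pers_hom_closed[OF h(1) x] Y in \<open>auto intro: persistence_module_fib cochain_complex_ob\<close>)
    with cl show "\<psi> i s x = \<phi> i s x \<oplus>\<^bsub>fib (ob Y i) s\<^esub>
       (df Y (i - 1) s (\<ominus>\<^bsub>fib (ob Y (i - 1)) s\<^esub> h i s x) \<oplus>\<^bsub>fib (ob Y i) s\<^esub>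
        \<ominus>\<^bsub>fib (ob Y (i + 1 - 1)) s\<^esub> h (i + 1) s (df X i s x))"
      by (simp add: eq[OF x] Y.a_assoc Y.r_neg flip: Y.minus_add)
  qed
qed

text \<open>The two homotopies add up, by additivity of the differential.\<close>

lemma homotopy_trans:
  assumes X: "cochain_complex K X" and Y: "cochain_complex K Y"
    and hom: "(\<phi>, \<psi>) \<in> homotopy_rel K X Y" and hom': "(\<psi>, \<theta>) \<in> homotopy_rel K X Y"
  shows "(\<phi>, \<theta>) \<in> homotopy_rel K X Y"
proof -
  note c = homotopy_rel_chain_maps[OF hom] homotopy_rel_chain_maps[OF hom']
  obtain h where h: "\<And>i. h i \<in> pers_hom K (ob X i) (ob Y (i - 1))"
      "\<And>i. h (i + 1) \<in> pers_hom K (ob X (i + 1)) (ob Y i)"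
    and eq: "\<And>i s x. x \<in> carrier (fib (ob X i) s) \<Longrightarrow> \<phi> i s x =
        \<psi> i s x \<oplus>\<^bsub>fib (ob Y i) s\<^esub> (df Y (i - 1) s (h i s x) \<oplus>\<^bsub>fib (ob Y i) s\<^esub> h (i + 1) s (df X i s x))"
    by (rule homotopyE[OF X Y hom]) (rule that)
  obtain k where k: "\<And>i. k i \<in> pers_hom K (ob X i) (ob Y (i - 1))"
      "\<And>i. k (i + 1) \<in> pers_hom K (ob X (i + 1)) (ob Y i)"
    and eq': "\<And>i s x. x \<in> carrier (fib (ob X i) s) \<Longrightarrow> \<psi> i s x =
        \<theta> i s x \<oplus>\<^bsub>fib (ob Y i) s\<^esub> (df Y (i - 1) s (k i s x) \<oplus>\<^bsub>fib (ob Y i) s\<^esub> k (i + 1) s (df X i s x))"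
    by (rule homotopyE[OF X Y hom']) (rule that)
  show ?thesis
  proof (rule homotopyI[OF X Y c(1) c(4)])
    show "(\<lambda>s x. h i s x \<oplus>\<^bsub>fib (ob Y (i - 1)) s\<^esub> k i s x) \<in> pers_hom K (ob X i) (ob Y (i - 1))" for i
      using Y h k by (intro pers_hom_pointwise_add cochain_complex_ob)
    fix i s x assume x: "x \<in> carrier (fib (ob X i) s)"
    interpret Y: abelian_group "fib (ob Y i) s"
      using Y cochain_complex_ob persistence_module_abelian_group by blast
    have cl: "\<theta> i s x \<in> carrier (fib (ob Y i) s)" "df Y (i - 1) s (h i s x) \<in> carrier (fib (ob Y i) s)"
       "h (i + 1) s (df X i s x) \<in> carrier (fib (ob Y i) s)"
       "df Y (i - 1) s (k i s x) \<in> carrier (fib (ob Y i) s)"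
       "k (i + 1) s (df X i s x) \<in> carrier (fib (ob Y i) s)"
      using x h k X Y c chain_maps_hom cochain_complex_df cochain_complex_df_pred
      by (meson pers_hom_closed)+
    have "df Y (i - 1) s (h i s x \<oplus>\<^bsub>fib (ob Y (i - 1)) s\<^esub> k i s x) =
        df Y (i - 1) s (h i s x) \<oplus>\<^bsub>fib (ob Y i) s\<^esub> df Y (i - 1) s (k i s x)"
      using pers_hom_add[OF cochain_complex_df_pred[OF Y]] pers_hom_closed[OF h(1) x]
        pers_hom_closed[OF k(1) x] by blast
    with cl show "\<phi> i s x = \<theta> i s x \<oplus>\<^bsub>fib (ob Y i) s\<^esub>
       (df Y (i - 1) s (h i s x \<oplus>\<^bsub>fib (ob Y (i - 1)) s\<^esub> k i s x) \<oplus>\<^bsub>fib (ob Y i) s\<^esub>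
        (h (i + 1) s (df X i s x) \<oplus>\<^bsub>fib (ob Y (i + 1 - 1)) s\<^esub> k (i + 1) s (df X i s x)))"
      by (simp add: eq[OF x] eq'[OF x] Y.a_ac)
  qed
qed

section \<open>Homotopies under composition and shift\<close>

text \<open>Applying \<open>\<gamma>\<close> to the homotopy gives a homotopy, because
  \<open>\<gamma>\<close> commutes with the differential in the term
  \<open>df Y (i - 1) s (h i s x)\<close>.\<close>

lemma homotopy_comp_left:
  assumes X: "cochain_complex K X" and Y: "cochain_complex K Y" and Z: "cochain_complex K Z"
    and hom: "(\<phi>, \<psi>) \<in> homotopy_rel K X Y" and \<gamma>: "\<gamma> \<in> chain_maps K Y Z"
  shows "(\<lambda>i. pers_comp (\<gamma> i) (\<phi> i), \<lambda>i. pers_comp (\<gamma> i) (\<psi> i)) \<in> homotopy_rel K X Z"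
proof -
  note c = homotopy_rel_chain_maps[OF hom]
  obtain h where h: "\<And>i. h i \<in> pers_hom K (ob X i) (ob Y (i - 1))"
      "\<And>i. h (i + 1) \<in> pers_hom K (ob X (i + 1)) (ob Y i)"
    and eq: "\<And>i s x. x \<in> carrier (fib (ob X i) s) \<Longrightarrow> \<phi> i s x =
        \<psi> i s x \<oplus>\<^bsub>fib (ob Y i) s\<^esub> (df Y (i - 1) s (h i s x) \<oplus>\<^bsub>fib (ob Y i) s\<^esub> h (i + 1) s (df X i s x))"
    by (rule homotopyE[OF X Y hom]) (rule that)
  show ?thesis
  proof (rule homotopyI[OF X Z chain_maps_comp[OF c(1) \<gamma>] chain_maps_comp[OF c(2) \<gamma>]])
    show "(\<lambda>s x. \<gamma> (i - 1) s (h i s x)) \<in> pers_hom K (ob X i) (ob Z (i - 1))" for i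
      by (rule pers_hom_comp[OF h(1) chain_maps_hom[OF \<gamma>]])
    fix i s x assume x: "x \<in> carrier (fib (ob X i) s)"
    interpret Y: abelian_group "fib (ob Y i) s"
      using Y cochain_complex_ob persistence_module_abelian_group by blast
    have cl: "\<psi> i s x \<in> carrier (fib (ob Y i) s)" "df Y (i - 1) s (h i s x) \<in> carrier (fib (ob Y i) s)"
       "h (i + 1) s (df X i s x) \<in> carrier (fib (ob Y i) s)" "h i s x \<in> carrier (fib (ob Y (i - 1)) s)"
      using x h X Y c chain_maps_hom cochain_complex_df cochain_complex_df_pred
      by (meson pers_hom_closed)+
    then show "pers_comp (\<gamma> i) (\<phi> i) s x = pers_comp (\<gamma> i) (\<psi> i) s x \<oplus>\<^bsub>fib (ob Z i) s\<^esub>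
       (df Z (i - 1) s (\<gamma> (i - 1) s (h i s x)) \<oplus>\<^bsub>fib (ob Z i) s\<^esub>
        \<gamma> (i + 1 - 1) s (h (i + 1) s (df X i s x)))"
      by (simp add: pers_comp_def eq[OF x] pers_hom_add[OF chain_maps_hom[OF \<gamma>]]
          chain_maps_df_pred[OF \<gamma>])
  qed
qed

text \<open>The formula for \<open>h\<close> is evaluated at \<open>\<phi> i s x\<close>; that
  \<open>\<phi>\<close> commutes with the differential puts the second term into the required
  shape.\<close>

lemma homotopy_comp_right:
  assumes X: "cochain_complex K X" and Y: "cochain_complex K Y" and Z: "cochain_complex K Z"
    and \<phi>: "\<phi> \<in> chain_maps K X Y" and hom: "(\<gamma>, \<delta>) \<in> homotopy_rel K Y Z"
  shows "(\<lambda>i. pers_comp (\<gamma> i) (\<phi> i), \<lambda>i. pers_comp (\<delta> i) (\<phi> i)) \<in> homotopy_rel K X Z"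
proof -
  note c = homotopy_rel_chain_maps[OF hom]
  obtain h where h: "\<And>i. h i \<in> pers_hom K (ob Y i) (ob Z (i - 1))"
      "\<And>i. h (i + 1) \<in> pers_hom K (ob Y (i + 1)) (ob Z i)"
    and eq: "\<And>i s x. x \<in> carrier (fib (ob Y i) s) \<Longrightarrow> \<gamma> i s x =
        \<delta> i s x \<oplus>\<^bsub>fib (ob Z i) s\<^esub> (df Z (i - 1) s (h i s x) \<oplus>\<^bsub>fib (ob Z i) s\<^esub> h (i + 1) s (df Y i s x))"
    by (rule homotopyE[OF Y Z hom]) (rule that)
  show ?thesis
  proof (rule homotopyI[OF X Z chain_maps_comp[OF \<phi> c(1)] chain_maps_comp[OF \<phi> c(2)]])
    show "(\<lambda>s x. h i s (\<phi> i s x)) \<in> pers_hom K (ob X i) (ob Z (i - 1))" for i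
      by (rule pers_hom_comp[OF chain_maps_hom[OF \<phi>] h(1)])
    fix i s x assume x: "x \<in> carrier (fib (ob X i) s)"
    show "pers_comp (\<gamma> i) (\<phi> i) s x = pers_comp (\<delta> i) (\<phi> i) s x \<oplus>\<^bsub>fib (ob Z i) s\<^esub>
       (df Z (i - 1) s (h i s (\<phi> i s x)) \<oplus>\<^bsub>fib (ob Z i) s\<^esub> h (i + 1) s (\<phi> (i + 1) s (df X i s x)))"
      using eq[OF pers_hom_closed[OF chain_maps_hom[OF \<phi>] x]]
      by (simp add: pers_comp_def chain_maps_df[OF \<phi> x])
  qed
qed

lemma homotopy_cshift:
  assumes X: "cochain_complex K X" and Y: "cochain_complex K Y"
    and hom: "(\<phi>, \<psi>) \<in> homotopy_rel K X Y"
  shows "(\<lambda>i. pshift_map \<epsilon> (\<phi> i), \<lambda>i. pshift_map \<epsilon> (\<psi> i)) \<in> homotopy_rel K (cshift \<epsilon> X) (cshift \<epsilon> Y)"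
proof -
  obtain h where h: "\<And>i. h i \<in> pers_hom K (ob X i) (ob Y (i - 1))"
      "\<And>i. h (i + 1) \<in> pers_hom K (ob X (i + 1)) (ob Y i)"
    and eq: "\<And>i s x. x \<in> carrier (fib (ob X i) s) \<Longrightarrow> \<phi> i s x =
        \<psi> i s x \<oplus>\<^bsub>fib (ob Y i) s\<^esub> (df Y (i - 1) s (h i s x) \<oplus>\<^bsub>fib (ob Y i) s\<^esub> h (i + 1) s (df X i s x))"
    by (rule homotopyE[OF X Y hom]) (rule that)
  show ?thesis
  proof (rule homotopyI[of _ _ _ _ _ "\<lambda>i. pshift_map \<epsilon> (h i)"])
    show "pshift_map \<epsilon> (h i) \<in> pers_hom K (ob (cshift \<epsilon> X) i) (ob (cshift \<epsilon> Y) (i - 1))" for i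
      using pers_hom_pshift[OF h(1)] by simp
    fix i s x assume "x \<in> carrier (fib (ob (cshift \<epsilon> X) i) s)"
    then show "pshift_map \<epsilon> (\<phi> i) s x = pshift_map \<epsilon> (\<psi> i) s x \<oplus>\<^bsub>fib (ob (cshift \<epsilon> Y) i) s\<^esub>
      (df (cshift \<epsilon> Y) (i - 1) s (pshift_map \<epsilon> (h i) s x) \<oplus>\<^bsub>fib (ob (cshift \<epsilon> Y) i) s\<^esub>
       pshift_map \<epsilon> (h (i + 1)) s (df (cshift \<epsilon> X) i s x))"
      using eq[of x i "s + vec \<epsilon>"] by (simp add: pshift_map_def)
  qed (intro cochain_complex_cshift chain_maps_cshift X Y homotopy_rel_chain_maps[OF hom])+
qed

section \<open>Homotopy classes and their representatives\<close>

lemma equiv_homotopy_rel: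
  assumes "cochain_complex K X" "cochain_complex K Y"
  shows "equiv (chain_maps K X Y) (homotopy_rel K X Y)"
proof (rule equivI)
  show "homotopy_rel K X Y \<subseteq> chain_maps K X Y \<times> chain_maps K X Y"
    by (auto dest: homotopy_rel_chain_maps)
  show "refl_on (chain_maps K X Y) (homotopy_rel K X Y)"
    by (intro refl_onI homotopy_refl[OF assms])
  show "sym (homotopy_rel K X Y)"
    by (rule symI) (rule homotopy_sym[OF assms])
  show "trans (homotopy_rel K X Y)"
    by (rule transI) (rule homotopy_trans[OF assms])
qed

lemma K_class_eq_iff:
  assumes "cochain_complex K X" "cochain_complex K Y" "\<phi> \<in> chain_maps K X Y" "\<psi> \<in> chain_maps K X Y"
  shows "K_class K X Y \<phi> = K_class K X Y \<psi> \<longleftrightarrow> (\<phi>, \<psi>) \<in> homotopy_rel K X Y"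
  unfolding K_class_def using eq_equiv_class_iff[OF equiv_homotopy_rel] assms by blast

lemma K_homE:
  assumes "F \<in> K_hom K X Y"
  obtains \<phi> where "\<phi> \<in> chain_maps K X Y" "F = K_class K X Y \<phi>"
  using assms by (auto simp: K_hom_def K_class_def elim: quotientE)

lemma K_class_in_K_hom: "\<phi> \<in> chain_maps K X Y \<Longrightarrow> K_class K X Y \<phi> \<in> K_hom K X Y"
  by (auto simp: K_hom_def K_class_def intro: quotientI)

text \<open>As shifts preserve homotopy, all members of the union in \<open>K_shift\<close> are the
  same class; the union is nonempty since \<open>\<phi>\<close> represents its own class.\<close>

lemma K_shift_class:
  assumes X: "cochain_complex K X" and Y: "cochain_complex K Y" and \<phi>: "\<phi> \<in> chain_maps K X Y"
  shows "K_shift K X Y \<epsilon> (K_class K X Y \<phi>) =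
    K_class K (cshift \<epsilon> X) (cshift \<epsilon> Y) (\<lambda>i. pshift_map \<epsilon> (\<phi> i))" (is "_ = ?C")
proof -
  have "K_class K (cshift \<epsilon> X) (cshift \<epsilon> Y) (\<lambda>i. pshift_map \<epsilon> (\<psi> i)) = ?C"
    if "\<psi> \<in> K_class K X Y \<phi>" for \<psi>
  proof -
    have "(\<phi>, \<psi>) \<in> homotopy_rel K X Y" using that by (simp add: K_class_def)
    then show ?thesis
      using X Y homotopy_cshift homotopy_rel_chain_maps chain_maps_cshift cochain_complex_cshift
        K_class_eq_iff by metis
  qed
  moreover have "\<phi> \<in> K_class K X Y \<phi>"
    using homotopy_refl[OF assms] by (simp add: K_class_def)
  ultimately show ?thesis unfolding K_shift_def by blast
qed

lemma K_comp_class: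
  assumes X: "cochain_complex K X" and Y: "cochain_complex K Y" and Z: "cochain_complex K Z"
    and \<phi>: "\<phi> \<in> chain_maps K X Y" and \<gamma>: "\<gamma> \<in> chain_maps K Y Z"
  shows "K_comp K X Z (K_class K Y Z \<gamma>) (K_class K X Y \<phi>) =
    K_class K X Z (\<lambda>i. pers_comp (\<gamma> i) (\<phi> i))" (is "_ = ?C")
proof -
  have "K_class K X Z (\<lambda>i. pers_comp (\<gamma>' i) (\<phi>' i)) = ?C"
    if "\<phi>' \<in> K_class K X Y \<phi>" "\<gamma>' \<in> K_class K Y Z \<gamma>" for \<phi>' \<gamma>'
  proof -
    have *: "(\<phi>, \<phi>') \<in> homotopy_rel K X Y" "(\<gamma>, \<gamma>') \<in> homotopy_rel K Y Z"
      using that by (simp_all add: K_class_def)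
    note c = homotopy_rel_chain_maps(2)[OF *(1)] homotopy_rel_chain_maps(2)[OF *(2)]
    \<comment> \<open>One factor is changed at a time: first \<open>\<phi>\<close> to
      \<open>\<phi>'\<close> under \<open>\<gamma>\<close>, then \<open>\<gamma>\<close> to
      \<open>\<gamma>'\<close> before \<open>\<phi>'\<close>.\<close>
    have "(\<lambda>i. pers_comp (\<gamma> i) (\<phi> i), \<lambda>i. pers_comp (\<gamma>' i) (\<phi>' i)) \<in> homotopy_rel K X Z"
      using homotopy_trans[OF X Z homotopy_comp_left[OF X Y Z *(1) \<gamma>]
          homotopy_comp_right[OF X Y Z c(1) *(2)]] .
    then show ?thesis
      using K_class_eq_iff[OF X Z chain_maps_comp[OF \<phi> \<gamma>] chain_maps_comp[OF c]] by simp
  qed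
  moreover have "\<phi> \<in> K_class K X Y \<phi>" "\<gamma> \<in> K_class K Y Z \<gamma>"
    using homotopy_refl[OF X Y \<phi>] homotopy_refl[OF Y Z \<gamma>] by (simp_all add: K_class_def)
  ultimately show ?thesis unfolding K_comp_def by blast
qed

section \<open>Augmented resolutions\<close>

text \<open>
  An acyclic complex in degrees \<open>\<le> 0\<close> over \<open>M\<close>, with the isomorphism \<open>H\<^sup>0(X) \<cong> M\<close> replaced by the
  augmentation \<open>a : X\<^sup>0 \<rightarrow> M\<close> it induces.
\<close>

definition augmented_resolution ::
  "('k, 'r) ring_scheme \<Rightarrow> ('n::finite, 'k, 'v) pcomplex \<Rightarrow> ('n, 'k, 'w) persmod
     \<Rightarrow> (real ^ 'n \<Rightarrow> 'v \<Rightarrow> 'w) \<Rightarrow> bool" where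
  "augmented_resolution K X M a \<longleftrightarrow>
     cochain_complex K X \<and> persistence_module K M \<and>
     (\<forall>i>0. pers_zero (ob X i)) \<and>
     (\<forall>j<0. \<forall>s. cocycles X j s \<subseteq> coboundaries X j s) \<and>
     a \<in> pers_hom K (ob X 0) M \<and>
     (\<forall>s. carrier (fib M s) \<subseteq> a s ` carrier (fib (ob X 0) s)) \<and>
     (\<forall>s. \<forall>x\<in>carrier (fib (ob X 0) s). a s x = \<zero>\<^bsub>fib M s\<^esub> \<longleftrightarrow> x \<in> coboundaries X 0 s)"

lemma augmented_resolutionD:
  assumes "augmented_resolution K X M a"
  shows "cochain_complex K X" "persistence_module K M"
    and "\<And>i. 0 < i \<Longrightarrow> pers_zero (ob X i)"
    and "\<And>j s x. \<lbrakk>j < 0; x \<in> carrier (fib (ob X j) s); df X j s x = \<zero>\<^bsub>fib (ob X (j + 1)) s\<^esub>\<rbrakk>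
      \<Longrightarrow> x \<in> coboundaries X j s"
    and "a \<in> pers_hom K (ob X 0) M"
    and "\<And>s m. m \<in> carrier (fib M s) \<Longrightarrow> m \<in> a s ` carrier (fib (ob X 0) s)"
    and "\<And>s x. x \<in> carrier (fib (ob X 0) s) \<Longrightarrow> a s x = \<zero>\<^bsub>fib M s\<^esub> \<longleftrightarrow> x \<in> coboundaries X 0 s"
  using assms unfolding augmented_resolution_def cocycles_def by blast+

lemma coboundaries_cshift: "coboundaries (cshift \<epsilon> X) j s = coboundaries X j (s + vec \<epsilon>)"
  by (simp add: coboundaries_def pshift_map_def)

lemma cocycles_cshift: "cocycles (cshift \<epsilon> X) j s = cocycles X j (s + vec \<epsilon>)"
  by (simp add: cocycles_def pshift_map_def)

text \<open>Exactness of the shift functor: every clause concerns a single point or a pair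
  \<open>s \<le> t\<close>, and translation by \<open>vec \<epsilon>\<close> preserves both.\<close>

lemma augmented_resolution_cshift:
  "augmented_resolution K X M a
    \<Longrightarrow> augmented_resolution K (cshift \<epsilon> X) (pshift \<epsilon> M) (pshift_map \<epsilon> a)"
  unfolding augmented_resolution_def coboundaries_cshift cocycles_cshift
  by (auto simp: cochain_complex_cshift persistence_module_pshift pers_hom_pshift pers_zero_def)
    (auto simp: pshift_map_def)

section \<open>Maps induced along augmentations\<close>

lemma augmentation_boundary:
  assumes "augmented_resolution K X M a" "x \<in> carrier (fib (ob X (- 1)) s)"
  shows "a s (df X (- 1) s x) = \<zero>\<^bsub>fib M s\<^esub>"
proof -
  note X = augmented_resolutionD[OF assms(1)]
  have "df X (- 1) s x \<in> coboundaries X 0 s"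
    using assms(2) by (simp add: coboundaries_def)
  moreover have "df X (- 1) s x \<in> carrier (fib (ob X 0) s)"
    using pers_hom_closed[OF cochain_complex_df[OF X(1), of "- 1"] assms(2)] by simp
  ultimately show ?thesis using X(7) by blast
qed

text \<open>In degree 0 the term \<open>h 1 s (df X 0 s x)\<close> vanishes because
  \<open>ob X 1\<close> is zero, so the two values differ by a boundary, which \<open>b\<close>
  kills.\<close>

lemma augmentation_homotopic_eq:
  assumes X: "cochain_complex K X" "pers_zero (ob X 1)" and Y: "augmented_resolution K Y N b"
    and hom: "(\<phi>, \<psi>) \<in> homotopy_rel K X Y" and x: "x \<in> carrier (fib (ob X 0) s)"
  shows "b s (\<phi> 0 s x) = b s (\<psi> 0 s x)"
proof -
  note Y' = augmented_resolutionD[OF Y] and c = homotopy_rel_chain_maps[OF hom]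
  interpret N: abelian_group "fib N s"
    using persistence_module_abelian_group[OF Y'(2)] .
  interpret Y: abelian_group "fib (ob Y 0) s"
    using persistence_module_abelian_group cochain_complex_ob[OF Y'(1)] by blast
  obtain h where h: "\<And>i. h i \<in> pers_hom K (ob X i) (ob Y (i - 1))"
      "\<And>i. h (i + 1) \<in> pers_hom K (ob X (i + 1)) (ob Y i)"
    and eq: "\<And>i s x. x \<in> carrier (fib (ob X i) s) \<Longrightarrow> \<phi> i s x =
        \<psi> i s x \<oplus>\<^bsub>fib (ob Y i) s\<^esub> (df Y (i - 1) s (h i s x) \<oplus>\<^bsub>fib (ob Y i) s\<^esub> h (i + 1) s (df X i s x))"
    by (rule homotopyE[OF X(1) Y'(1) hom]) (rule that)
  have "df X 0 s x = \<zero>\<^bsub>fib (ob X 1) s\<^esub>"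
    using X(2) pers_hom_closed[OF cochain_complex_df[OF X(1)] x] by (simp add: pers_zero_def)
  then have "h 1 s (df X 0 s x) = \<zero>\<^bsub>fib (ob Y 0) s\<^esub>"
    using pers_hom_zero[OF _ _ h(2)[of 0]] cochain_complex_ob[OF X(1)] cochain_complex_ob[OF Y'(1)]
    by simp
  moreover have hx: "h 0 s x \<in> carrier (fib (ob Y (- 1)) s)"
    using pers_hom_closed[OF h(1) x] by simp
  moreover have dhx: "df Y (- 1) s (h 0 s x) \<in> carrier (fib (ob Y 0) s)"
    using pers_hom_closed[OF cochain_complex_df[OF Y'(1), of "- 1"] hx] by simp
  moreover have \<psi>x: "\<psi> 0 s x \<in> carrier (fib (ob Y 0) s)"
    using pers_hom_closed[OF chain_maps_hom[OF c(2)] x] .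
  ultimately have "\<phi> 0 s x = \<psi> 0 s x \<oplus>\<^bsub>fib (ob Y 0) s\<^esub> df Y (- 1) s (h 0 s x)"
    using eq[OF x] by simp
  then have "b s (\<phi> 0 s x) = b s (\<psi> 0 s x) \<oplus>\<^bsub>fib N s\<^esub> b s (df Y (- 1) s (h 0 s x))"
    using pers_hom_add[OF Y'(5) \<psi>x dhx] by simp
  then show ?thesis
    using augmentation_boundary[OF Y hx] pers_hom_closed[OF Y'(5) \<psi>x] by simp
qed

text \<open>The augmentation exhibits \<open>M\<close> as the cokernel of the last differential, so
  a chain map descends to it. This is the action of \<open>H^0\<close>, expressed without
  cosets.\<close>

lemma augmentation_induced_hom:
  assumes X: "augmented_resolution K X M a" and Y: "augmented_resolution K Y N b"
    and \<phi>: "\<phi> \<in> chain_maps K X Y"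
  obtains f where "f \<in> pers_hom K M N"
    and "\<And>s x. x \<in> carrier (fib (ob X 0) s) \<Longrightarrow> f s (a s x) = b s (\<phi> 0 s x)"
proof -
  note X' = augmented_resolutionD[OF X] and Y' = augmented_resolutionD[OF Y]
  note \<phi>0 = chain_maps_hom[OF \<phi>, of 0]
  \<comment> \<open>A merely set-theoretic section of \<open>a\<close>. Linearity and naturality of
    the induced map come not from \<open>c\<close> but from independence of the chosen
    preimage.\<close>
  define c where "c = (\<lambda>s m. SOME x. x \<in> carrier (fib (ob X 0) s) \<and> a s x = m)"
  have c: "c s m \<in> carrier (fib (ob X 0) s)" "a s (c s m) = m" if "m \<in> carrier (fib M s)" for s m
    using someI_ex[of "\<lambda>x. x \<in> carrier (fib (ob X 0) s) \<and> a s x = m"] X'(6)[OF that]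
    by (auto simp: c_def)
  note b\<phi> = pers_hom_comp[OF \<phi>0 Y'(5)]
  \<comment> \<open>The difference of two preimages is a boundary \<open>df X (- 1) s w\<close>; the
    chain map turns it into a boundary in \<open>Y\<close>, on which \<open>b\<close> is
    zero.\<close>
  have indep: "b s (\<phi> 0 s x) = b s (\<phi> 0 s y)"
    if x: "x \<in> carrier (fib (ob X 0) s)" and y: "y \<in> carrier (fib (ob X 0) s)" and eq: "a s x = a s y"
    for s x y
  proof -
    interpret X: abelian_group "fib (ob X 0) s"
      using persistence_module_abelian_group cochain_complex_ob[OF X'(1)] by blast
    interpret M: abelian_group "fib M s" using persistence_module_abelian_group[OF X'(2)] .
    interpret N: abelian_group "fib N s" using persistence_module_abelian_group[OF Y'(2)] .
    let ?z = "x \<ominus>\<^bsub>fib (ob X 0) s\<^esub> y"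
    have z: "?z \<in> carrier (fib (ob X 0) s)" using x y by simp
    have "a s ?z = \<zero>\<^bsub>fib M s\<^esub>"
      using pers_hom_diff[OF cochain_complex_ob[OF X'(1)] X'(2) X'(5) x y] eq
        pers_hom_closed[OF X'(5) y] by (simp add: a_minus_def M.r_neg)
    then obtain w where w: "w \<in> carrier (fib (ob X (- 1)) s)" "?z = df X (- 1) s w"
      using X'(7)[OF z] by (auto simp: coboundaries_def)
    have "\<phi> 0 s ?z = df Y (- 1) s (\<phi> (- 1) s w)"
      using chain_maps_df[OF \<phi> w(1)] w(2) by simp
    then have "b s (\<phi> 0 s ?z) = \<zero>\<^bsub>fib N s\<^esub>"
      using augmentation_boundary[OF Y pers_hom_closed[OF chain_maps_hom[OF \<phi>] w(1)]] by simp
    moreover have "b s (\<phi> 0 s ?z) = b s (\<phi> 0 s x) \<ominus>\<^bsub>fib N s\<^esub> b s (\<phi> 0 s y)"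
      using pers_hom_diff[OF cochain_complex_ob[OF X'(1)] Y'(2) b\<phi> x y] .
    ultimately show ?thesis
      using abelian_group_diff_eq_iff[OF N.abelian_group_axioms pers_hom_closed[OF b\<phi> x]
          pers_hom_closed[OF b\<phi> y] N.zero_closed] pers_hom_closed[OF b\<phi> y] by simp
  qed
  define f where "f = (\<lambda>s m. b s (\<phi> 0 s (c s m)))"
  have f: "f s (a s x) = b s (\<phi> 0 s x)" if "x \<in> carrier (fib (ob X 0) s)" for s x
    using indep[OF c(1) that] c(2) pers_hom_closed[OF X'(5) that] by (simp add: f_def)
  have surj: "\<exists>x\<in>carrier (fib (ob X 0) s). m = a s x" if "m \<in> carrier (fib M s)" for s m
    using X'(6)[OF that] by auto
  \<comment> \<open>Each law is transported from \<open>b\<close> after \<open>\<phi> 0\<close> by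
    writing every element of \<open>M\<close> as \<open>a s x\<close>.\<close>
  have "f \<in> pers_hom K M N"
  proof (intro pers_homI linear_mapsI)
    interpret X: Module.module K "fib (ob X 0) s" for s
      using persistence_module_fib cochain_complex_ob[OF X'(1)] by blast
    fix s m assume "m \<in> carrier (fib M s)"
    then obtain x where x: "x \<in> carrier (fib (ob X 0) s)" "m = a s x" using surj by blast
    then show "f s m \<in> carrier (fib N s)"
      using f pers_hom_closed[OF b\<phi> x(1)] by simp
    show "f s (k \<odot>\<^bsub>fib M s\<^esub> m) = k \<odot>\<^bsub>fib N s\<^esub> f s m" if "k \<in> carrier K" for k
      using f[of "k \<odot>\<^bsub>fib (ob X 0) s\<^esub> x" s] f[OF x(1)] x that
      by (simp add: pers_hom_smult[OF X'(5)] pers_hom_smult[OF b\<phi>])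
    show "f t (tr M s t m) = tr N s t (f s m)" if "s \<le> t" for t
      using f[OF linear_maps_closed[OF persistence_module_tr[OF cochain_complex_ob[OF X'(1)] that] x(1)]]
        f[OF x(1)] x that by (simp add: pers_hom_tr[OF X'(5)] pers_hom_tr[OF b\<phi>])
    show "f s (m \<oplus>\<^bsub>fib M s\<^esub> m') = f s m \<oplus>\<^bsub>fib N s\<^esub> f s m'" if "m' \<in> carrier (fib M s)" for m'
    proof -
      obtain y where y: "y \<in> carrier (fib (ob X 0) s)" "m' = a s y" using surj \<open>m' \<in> _\<close> by blast
      show ?thesis
        using f[of "x \<oplus>\<^bsub>fib (ob X 0) s\<^esub> y" s] f[OF x(1)] f[OF y(1)] x y
        by (simp add: pers_hom_add[OF X'(5)] pers_hom_add[OF b\<phi>])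
    qed
  qed
  then show thesis using f by (rule that)
qed

section \<open>The comparison theorem\<close>

text \<open>One step down the degrees. The last conclusion is the hypothesis \<open>bd\<close> one
  degree lower, which makes the step repeatable: the new component after the differential is a
  cocycle by \<open>d d = 0\<close>, hence a coboundary, because \<open>j \<le> 0\<close> puts
  degree \<open>j - 1\<close> in the negative range where \<open>Y\<close> is exact.\<close>

lemma comparison_step:
  fixes X Y :: "('n::finite, 'k, 'v) pcomplex"
  assumes X: "cochain_complex K X" and proj: "pers_projective K (ob X (j - 1))"
    and Y: "augmented_resolution K Y N b" and "j \<le> 0"
    and \<phi>: "\<phi> \<in> pers_hom K (ob X j) (ob Y j)"
    and bd: "\<And>s x. x \<in> carrier (fib (ob X (j - 1)) s) \<Longrightarrow> \<phi> s (df X (j - 1) s x) \<in> coboundaries Y j s"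
  obtains \<phi>' where "\<phi>' \<in> pers_hom K (ob X (j - 1)) (ob Y (j - 1))"
    and "\<And>s x. x \<in> carrier (fib (ob X (j - 1)) s) \<Longrightarrow> df Y (j - 1) s (\<phi>' s x) = \<phi> s (df X (j - 1) s x)"
    and "\<And>s x. x \<in> carrier (fib (ob X (j - 1 - 1)) s)
      \<Longrightarrow> \<phi>' s (df X (j - 1 - 1) s x) \<in> coboundaries Y (j - 1) s"
proof -
  note Y' = augmented_resolutionD[OF Y]
  obtain \<phi>' where \<phi>': "\<phi>' \<in> pers_hom K (ob X (j - 1)) (ob Y (j - 1))"
    and eq: "\<And>s x. x \<in> carrier (fib (ob X (j - 1)) s) \<Longrightarrow> df Y (j - 1) s (\<phi>' s x) = \<phi> s (df X (j - 1) s x)"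
    by (rule projective_lift_through_image[OF proj cochain_complex_ob[OF Y'(1)] cochain_complex_ob[OF Y'(1)]
          cochain_complex_df_pred[OF Y'(1)] pers_hom_comp[OF cochain_complex_df_pred[OF X] \<phi>]])
      (rule bd[unfolded coboundaries_def], assumption, rule that)
  have "\<phi>' s (df X (j - 1 - 1) s x) \<in> coboundaries Y (j - 1) s"
    if x: "x \<in> carrier (fib (ob X (j - 1 - 1)) s)" for s x
  proof (rule Y'(4))
    have dx: "df X (j - 1 - 1) s x \<in> carrier (fib (ob X (j - 1)) s)"
      using pers_hom_closed[OF cochain_complex_df_pred[OF X] x] .
    show "\<phi>' s (df X (j - 1 - 1) s x) \<in> carrier (fib (ob Y (j - 1)) s)"
      using pers_hom_closed[OF \<phi>' dx] .
    show "df Y (j - 1) s (\<phi>' s (df X (j - 1 - 1) s x)) = \<zero>\<^bsub>fib (ob Y (j - 1 + 1)) s\<^esub>"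
      using eq[OF dx] cochain_complex_df_df_pred[OF X x]
        pers_hom_zero[OF cochain_complex_ob[OF X] cochain_complex_ob[OF Y'(1)] \<phi>] by simp
  qed (use \<open>j \<le> 0\<close> in simp)
  with \<phi>' eq show thesis by (rule that)
qed

lemma comparison_exists:
  fixes X Y :: "('n::finite, 'k, 'v) pcomplex" and N :: "('n, 'k, 'v) persmod"
  assumes X: "augmented_resolution K X M a" and proj: "\<And>i. pers_projective K (ob X i)"
    and Y: "augmented_resolution K Y N b" and f: "f \<in> pers_hom K M N"
  obtains \<phi> where "\<phi> \<in> chain_maps K X Y"
    and "\<And>s x. x \<in> carrier (fib (ob X 0) s) \<Longrightarrow> b s (\<phi> 0 s x) = f s (a s x)"
proof -
  note X' = augmented_resolutionD[OF X] and Y' = augmented_resolutionD[OF Y]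
  \<comment> \<open>Index \<open>n\<close> stands for degree \<open>- int n\<close>, so dependent
    choice over the naturals runs down the complex. \<open>P n\<close> carries the condition under
    which the next lift exists, \<open>Q n\<close> is the commuting square between consecutive
    components, and the clause for \<open>n = 0\<close> keeps the augmentation equation through the
    choice.\<close>
  define P where "P n \<phi> \<longleftrightarrow> \<phi> \<in> pers_hom K (ob X (- int n)) (ob Y (- int n)) \<and>
      (\<forall>s. \<forall>x\<in>carrier (fib (ob X (- int n - 1)) s). \<phi> s (df X (- int n - 1) s x) \<in> coboundaries Y (- int n) s) \<and>
      (n = 0 \<longrightarrow> (\<forall>s. \<forall>x\<in>carrier (fib (ob X 0) s). b s (\<phi> s x) = f s (a s x)))" for n \<phi>
  define Q where "Q n \<phi> \<phi>' \<longleftrightarrow> (\<forall>s. \<forall>x\<in>carrier (fib (ob X (- int n - 1)) s).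
      df Y (- int n - 1) s (\<phi>' s x) = \<phi> s (df X (- int n - 1) s x))" for n \<phi> \<phi>'
  have "\<exists>\<phi>. P 0 \<phi>"
  proof -
    \<comment> \<open>Surjectivity of \<open>b\<close> puts the values of \<open>f\<close> after
      \<open>a\<close> into its image, so projectivity of \<open>ob X 0\<close> applies.\<close>
    obtain \<phi> where \<phi>: "\<phi> \<in> pers_hom K (ob X 0) (ob Y 0)"
      and eq: "\<And>s x. x \<in> carrier (fib (ob X 0) s) \<Longrightarrow> b s (\<phi> s x) = f s (a s x)"
      by (rule projective_lift_through_image[OF proj cochain_complex_ob[OF Y'(1)] Y'(2) Y'(5)
            pers_hom_comp[OF X'(5) f]])
        (rule Y'(6)[OF pers_hom_closed[OF pers_hom_comp[OF X'(5) f]]], assumption, rule that)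
    have "\<phi> s (df X (- 1) s x) \<in> coboundaries Y 0 s" if x: "x \<in> carrier (fib (ob X (- 1)) s)" for s x
    proof -
      have dx: "df X (- 1) s x \<in> carrier (fib (ob X 0) s)"
        using pers_hom_closed[OF cochain_complex_df[OF X'(1), of "- 1"] x] by simp
      have "b s (\<phi> s (df X (- 1) s x)) = \<zero>\<^bsub>fib N s\<^esub>"
        using eq[OF dx] augmentation_boundary[OF X x] pers_hom_zero[OF X'(2) Y'(2) f] by simp
      then show ?thesis using Y'(7)[OF pers_hom_closed[OF \<phi> dx]] by blast
    qed
    with \<phi> eq have "P 0 \<phi>" by (simp add: P_def)
    then show ?thesis by blast
  qed
  moreover have "\<exists>\<phi>'. P (Suc n) \<phi>' \<and> Q n \<phi> \<phi>'" if "P n \<phi>" for n \<phi>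
  proof -
    have n: "- int (Suc n) = - int n - 1" by simp
    have \<phi>: "\<phi> \<in> pers_hom K (ob X (- int n)) (ob Y (- int n))"
      and bd: "\<And>s x. x \<in> carrier (fib (ob X (- int n - 1)) s)
        \<Longrightarrow> \<phi> s (df X (- int n - 1) s x) \<in> coboundaries Y (- int n) s"
      using that by (simp_all add: P_def)
    obtain \<phi>' where "\<phi>' \<in> pers_hom K (ob X (- int n - 1)) (ob Y (- int n - 1))"
      "\<And>s x. x \<in> carrier (fib (ob X (- int n - 1)) s)
        \<Longrightarrow> df Y (- int n - 1) s (\<phi>' s x) = \<phi> s (df X (- int n - 1) s x)"
      "\<And>s x. x \<in> carrier (fib (ob X (- int n - 1 - 1)) s)
        \<Longrightarrow> \<phi>' s (df X (- int n - 1 - 1) s x) \<in> coboundaries Y (- int n - 1) s"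
      by (rule comparison_step[OF X'(1) proj Y _ \<phi> bd]) (simp, assumption, rule that)
    then have "P (Suc n) \<phi>' \<and> Q n \<phi> \<phi>'"
      unfolding P_def Q_def n by simp
    then show ?thesis by blast
  qed
  ultimately obtain \<Phi> where \<Phi>: "\<And>n. P n (\<Phi> n)" "\<And>n. Q n (\<Phi> n) (\<Phi> (Suc n))"
    using dependent_nat_choice[of P Q] by blast
  \<comment> \<open>In positive degrees \<open>ob Y i\<close> is zero, so zero is the only possible
    value.\<close>
  define \<phi> where "\<phi> i = (if i \<le> 0 then \<Phi> (nat (- i)) else (\<lambda>s x. \<zero>\<^bsub>fib (ob Y i) s\<^esub>))" for i
  have hom: "\<phi> i \<in> pers_hom K (ob X i) (ob Y i)" for i
    using \<Phi>(1)[of "nat (- i)"] pers_hom_const_zero[OF cochain_complex_ob[OF Y'(1)]]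
    by (cases "i \<le> 0") (simp_all add: \<phi>_def P_def)
  have "\<phi> (i + 1) s (df X i s x) = df Y i s (\<phi> i s x)" if x: "x \<in> carrier (fib (ob X i) s)" for i s x
  proof (cases "0 \<le> i")
    \<comment> \<open>This includes the border \<open>i = 0\<close>: there \<open>\<phi> 1\<close>
      is zero by definition and the other side lies in a fibre of the zero module
      \<open>ob Y 1\<close>.\<close>
    case True
    then have "carrier (fib (ob Y (i + 1)) s) = {\<zero>\<^bsub>fib (ob Y (i + 1)) s\<^esub>}"
      using Y'(3)[of "i + 1"] by (simp add: pers_zero_def)
    with True show ?thesis
      using pers_hom_closed[OF cochain_complex_df[OF Y'(1)] pers_hom_closed[OF hom x]]
      by (simp add: \<phi>_def)
  next
    case False
    \<comment> \<open>With this \<open>n\<close>, degrees \<open>i + 1\<close> and \<open>i\<close>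
      have indices \<open>n\<close> and \<open>Suc n\<close>, the pair joined by
      \<open>Q n\<close>.\<close>
    define n where "n = nat (- i - 1)"
    have n: "- int n - 1 = i" "\<phi> (i + 1) = \<Phi> n" "\<phi> i = \<Phi> (Suc n)"
      using False by (auto simp: n_def \<phi>_def Suc_nat_eq_nat_zadd1)
    show ?thesis
      using \<Phi>(2)[of n] x by (simp add: Q_def n)
  qed
  with hom have "\<phi> \<in> chain_maps K X Y"
    by (simp add: chain_maps_def pers_eq_def pers_comp_def)
  then show thesis
    using \<Phi>(1)[of 0] by (intro that[of \<phi>]) (simp_all add: P_def \<phi>_def)
qed

section \<open>Uniqueness of lifts up to homotopy\<close>

lemma chain_maps_diff:
  assumes X: "cochain_complex K X" and Y: "cochain_complex K Y"
    and \<phi>: "\<phi> \<in> chain_maps K X Y" and \<psi>: "\<psi> \<in> chain_maps K X Y"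
  shows "(\<lambda>i s x. \<phi> i s x \<ominus>\<^bsub>fib (ob Y i) s\<^esub> \<psi> i s x) \<in> chain_maps K X Y"
  using pers_hom_pointwise_diff[OF cochain_complex_ob[OF Y] chain_maps_hom[OF \<phi>] chain_maps_hom[OF \<psi>]]
    pers_hom_diff[OF cochain_complex_ob[OF Y] cochain_complex_ob[OF Y] cochain_complex_df[OF Y]
      pers_hom_closed[OF chain_maps_hom[OF \<phi>]] pers_hom_closed[OF chain_maps_hom[OF \<psi>]]]
  by (simp add: chain_maps_def[of K X Y] pers_eq_def pers_comp_def chain_maps_df[OF \<phi>] chain_maps_df[OF \<psi>])

text \<open>What is carried along is the homotopy formula in degree \<open>j\<close> precomposed
  with the differential, \<open>d h d = \<delta> d\<close>. It makes \<open>\<delta> - h d\<close>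
  in degree \<open>j - 1\<close> a cocycle, hence a coboundary, and projectivity lifts it to
  \<open>h'\<close>. Precomposing \<open>d h' = \<delta> - h d\<close> with the differential kills
  \<open>h d d\<close> and returns the hypothesis one degree lower.\<close>

lemma null_homotopy_step:
  fixes X Y :: "('n::finite, 'k, 'v) pcomplex"
  assumes X: "cochain_complex K X" and proj: "pers_projective K (ob X (j - 1))"
    and Y: "augmented_resolution K Y N b" and "j \<le> 0"
    and \<delta>: "\<delta> \<in> chain_maps K X Y" and h: "h \<in> pers_hom K (ob X j) (ob Y (j - 1))"
    and dhd: "\<And>s x. x \<in> carrier (fib (ob X (j - 1)) s)
      \<Longrightarrow> df Y (j - 1) s (h s (df X (j - 1) s x)) = \<delta> j s (df X (j - 1) s x)"
  obtains h' where "h' \<in> pers_hom K (ob X (j - 1)) (ob Y (j - 1 - 1))"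
    and "\<And>s x. x \<in> carrier (fib (ob X (j - 1)) s) \<Longrightarrow> df Y (j - 1 - 1) s (h' s x) =
      \<delta> (j - 1) s x \<ominus>\<^bsub>fib (ob Y (j - 1)) s\<^esub> h s (df X (j - 1) s x)"
    and "\<And>s x. x \<in> carrier (fib (ob X (j - 1 - 1)) s)
      \<Longrightarrow> df Y (j - 1 - 1) s (h' s (df X (j - 1 - 1) s x)) = \<delta> (j - 1) s (df X (j - 1 - 1) s x)"
proof -
  note Y' = augmented_resolutionD[OF Y]
  note obX = cochain_complex_ob[OF X] and obY = cochain_complex_ob[OF Y'(1)]
  note hd = pers_hom_comp[OF cochain_complex_df_pred[OF X] h]
  let ?k = "\<lambda>s x. \<delta> (j - 1) s x \<ominus>\<^bsub>fib (ob Y (j - 1)) s\<^esub> h s (df X (j - 1) s x)"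
  have k: "?k \<in> pers_hom K (ob X (j - 1)) (ob Y (j - 1))"
    using pers_hom_pointwise_diff[OF obY chain_maps_hom[OF \<delta>] hd] .
  have im: "?k s x \<in> df Y (j - 1 - 1) s ` carrier (fib (ob Y (j - 1 - 1)) s)"
    if x: "x \<in> carrier (fib (ob X (j - 1)) s)" for s x
  proof -
    interpret Y: abelian_group "fib (ob Y j) s" using persistence_module_abelian_group[OF obY] .
    have "\<delta> j s (df X (j - 1) s x) \<in> carrier (fib (ob Y j) s)"
      using pers_hom_closed[OF chain_maps_hom[OF \<delta>] pers_hom_closed[OF cochain_complex_df_pred[OF X] x]] .
    then have "df Y (j - 1) s (?k s x) = \<zero>\<^bsub>fib (ob Y j) s\<^esub>"
      using pers_hom_diff[OF obY obY cochain_complex_df_pred[OF Y'(1)]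
          pers_hom_closed[OF chain_maps_hom[OF \<delta>] x] pers_hom_closed[OF hd x]]
      by (simp add: dhd[OF x] chain_maps_df_pred[OF \<delta> x, symmetric] a_minus_def Y.r_neg)
    then have "?k s x \<in> coboundaries Y (j - 1) s"
      using \<open>j \<le> 0\<close> pers_hom_closed[OF k x] by (intro Y'(4)) auto
    then show ?thesis by (simp add: coboundaries_def)
  qed
  obtain h' where h': "h' \<in> pers_hom K (ob X (j - 1)) (ob Y (j - 1 - 1))"
    and eq: "\<And>s x. x \<in> carrier (fib (ob X (j - 1)) s) \<Longrightarrow> df Y (j - 1 - 1) s (h' s x) = ?k s x"
    by (rule projective_lift_through_image[OF proj obY obY cochain_complex_df_pred[OF Y'(1)] k im])
      (assumption, rule that)
  have "df Y (j - 1 - 1) s (h' s (df X (j - 1 - 1) s x)) = \<delta> (j - 1) s (df X (j - 1 - 1) s x)"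
    if x: "x \<in> carrier (fib (ob X (j - 1 - 1)) s)" for s x
  proof -
    interpret Y: abelian_group "fib (ob Y (j - 1)) s" using persistence_module_abelian_group[OF obY] .
    have dx: "df X (j - 1 - 1) s x \<in> carrier (fib (ob X (j - 1)) s)"
      using pers_hom_closed[OF cochain_complex_df_pred[OF X] x] .
    have "h s (df X (j - 1) s (df X (j - 1 - 1) s x)) = \<zero>\<^bsub>fib (ob Y (j - 1)) s\<^esub>"
      using cochain_complex_df_df_pred[OF X x] pers_hom_zero[OF obX obY h] by simp
    then show ?thesis
      using eq[OF dx] pers_hom_closed[OF chain_maps_hom[OF \<delta>] dx] by (simp add: a_minus_def)
  qed
  with h' eq show thesis by (rule that)
qed

lemma comparison_unique:
  fixes X Y :: "('n::finite, 'k, 'v) pcomplex"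
  assumes X: "augmented_resolution K X M a" and proj: "\<And>i. pers_projective K (ob X i)"
    and Y: "augmented_resolution K Y N b" and \<phi>: "\<phi> \<in> chain_maps K X Y" and \<psi>: "\<psi> \<in> chain_maps K X Y"
    and eq: "\<And>s x. x \<in> carrier (fib (ob X 0) s) \<Longrightarrow> b s (\<phi> 0 s x) = b s (\<psi> 0 s x)"
  shows "(\<phi>, \<psi>) \<in> homotopy_rel K X Y"
proof -
  note X' = augmented_resolutionD[OF X] and Y' = augmented_resolutionD[OF Y]
  note obX = cochain_complex_ob[OF X'(1)] and obY = cochain_complex_ob[OF Y'(1)]
  define \<delta> where "\<delta> = (\<lambda>i s x. \<phi> i s x \<ominus>\<^bsub>fib (ob Y i) s\<^esub> \<psi> i s x)"
  have \<delta>: "\<delta> \<in> chain_maps K X Y"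
    unfolding \<delta>_def by (rule chain_maps_diff[OF X'(1) Y'(1) \<phi> \<psi>])
  \<comment> \<open>As for existence, \<open>n\<close> indexes degree \<open>- int n\<close>. The
    clause for \<open>n = 0\<close> is stronger than \<open>d h d = \<delta> d\<close>: it is the
    whole homotopy formula in degree 0, where \<open>h 1\<close> will be zero. \<open>Q n\<close> is
    the formula in degree \<open>- int n - 1\<close>, solved for the new component.\<close>
  define P where "P n h \<longleftrightarrow> h \<in> pers_hom K (ob X (- int n)) (ob Y (- int n - 1)) \<and>
      (\<forall>s. \<forall>x\<in>carrier (fib (ob X (- int n - 1)) s).
        df Y (- int n - 1) s (h s (df X (- int n - 1) s x)) = \<delta> (- int n) s (df X (- int n - 1) s x)) \<and>
      (n = 0 \<longrightarrow> (\<forall>s. \<forall>x\<in>carrier (fib (ob X 0) s). df Y (- 1) s (h s x) = \<delta> 0 s x))" for n h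
  define Q where "Q n h h' \<longleftrightarrow> (\<forall>s. \<forall>x\<in>carrier (fib (ob X (- int n - 1)) s).
      df Y (- int n - 1 - 1) s (h' s x) =
        \<delta> (- int n - 1) s x \<ominus>\<^bsub>fib (ob Y (- int n - 1)) s\<^esub> h s (df X (- int n - 1) s x))" for n h h'
  have "\<exists>h. P 0 h"
  proof -
    \<comment> \<open>The index \<open>0 - 1\<close> stays unevaluated so that the fact matches the
      rule for the differential entering degree \<open>i\<close>, taken at \<open>i = 0\<close>. The
      inclusion itself says that \<open>\<delta> 0\<close> lies in the kernel of
      \<open>b\<close>.\<close>
    have im: "\<delta> 0 s x \<in> df Y (0 - 1) s ` carrier (fib (ob Y (0 - 1)) s)"
      if x: "x \<in> carrier (fib (ob X 0) s)" for s x
    proof -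
      interpret N: abelian_group "fib N s" using persistence_module_abelian_group[OF Y'(2)] .
      have \<phi>x: "\<phi> 0 s x \<in> carrier (fib (ob Y 0) s)" and \<psi>x: "\<psi> 0 s x \<in> carrier (fib (ob Y 0) s)"
        using pers_hom_closed[OF chain_maps_hom[OF \<phi>] x] pers_hom_closed[OF chain_maps_hom[OF \<psi>] x] .
      have "b s (\<delta> 0 s x) = \<zero>\<^bsub>fib N s\<^esub>"
        using pers_hom_diff[OF obY Y'(2) Y'(5) \<phi>x \<psi>x] eq[OF x] pers_hom_closed[OF Y'(5) \<psi>x]
        by (simp add: \<delta>_def a_minus_def N.r_neg)
      then show ?thesis
        using Y'(7)[OF pers_hom_closed[OF chain_maps_hom[OF \<delta>] x]] by (simp add: coboundaries_def)
    qed
    obtain h where h: "h \<in> pers_hom K (ob X 0) (ob Y (0 - 1))"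
      and dh: "\<And>s x. x \<in> carrier (fib (ob X 0) s) \<Longrightarrow> df Y (0 - 1) s (h s x) = \<delta> 0 s x"
      by (rule projective_lift_through_image[OF proj obY obY cochain_complex_df_pred[OF Y'(1)]
            chain_maps_hom[OF \<delta>] im]) (assumption, rule that)
    have "df X (- 1) s x \<in> carrier (fib (ob X 0) s)" if "x \<in> carrier (fib (ob X (- 1)) s)" for s x
      using pers_hom_closed[OF cochain_complex_df[OF X'(1), of "- 1"] that] by simp
    with h dh have "P 0 h" by (simp add: P_def)
    then show ?thesis by blast
  qed
  moreover have "\<exists>h'. P (Suc n) h' \<and> Q n h h'" if "P n h" for n h
  proof -
    have n: "- int (Suc n) = - int n - 1" by simp
    have h: "h \<in> pers_hom K (ob X (- int n)) (ob Y (- int n - 1))"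
      and dhd: "\<And>s x. x \<in> carrier (fib (ob X (- int n - 1)) s) \<Longrightarrow>
        df Y (- int n - 1) s (h s (df X (- int n - 1) s x)) = \<delta> (- int n) s (df X (- int n - 1) s x)"
      using that by (simp_all add: P_def)
    obtain h' where "h' \<in> pers_hom K (ob X (- int n - 1)) (ob Y (- int n - 1 - 1))"
      "\<And>s x. x \<in> carrier (fib (ob X (- int n - 1)) s) \<Longrightarrow> df Y (- int n - 1 - 1) s (h' s x) =
        \<delta> (- int n - 1) s x \<ominus>\<^bsub>fib (ob Y (- int n - 1)) s\<^esub> h s (df X (- int n - 1) s x)"
      "\<And>s x. x \<in> carrier (fib (ob X (- int n - 1 - 1)) s) \<Longrightarrow>
        df Y (- int n - 1 - 1) s (h' s (df X (- int n - 1 - 1) s x)) = \<delta> (- int n - 1) s (df X (- int n - 1 - 1) s x)"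
      by (rule null_homotopy_step[OF X'(1) proj Y _ \<delta> h dhd]) (simp, assumption, rule that)
    then have "P (Suc n) h' \<and> Q n h h'"
      unfolding P_def Q_def n by simp
    then show ?thesis by blast
  qed
  ultimately obtain H where H: "\<And>n. P n (H n)" "\<And>n. Q n (H n) (H (Suc n))"
    using dependent_nat_choice[of P Q] by blast
  define h where "h i = (if i \<le> 0 then H (nat (- i)) else (\<lambda>s x. \<zero>\<^bsub>fib (ob Y (i - 1)) s\<^esub>))" for i
  have hom: "h i \<in> pers_hom K (ob X i) (ob Y (i - 1))" for i
    using H(1)[of "nat (- i)"] pers_hom_const_zero[OF obY]
    by (cases "i \<le> 0") (simp_all add: h_def P_def)
  have "\<delta> i s x = df Y (i - 1) s (h i s x) \<oplus>\<^bsub>fib (ob Y i) s\<^esub> h (i + 1) s (df X i s x)"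
    if x: "x \<in> carrier (fib (ob X i) s)" for i s x
  proof -
    interpret Y: abelian_group "fib (ob Y i) s" using persistence_module_abelian_group[OF obY] .
    have \<delta>x: "\<delta> i s x \<in> carrier (fib (ob Y i) s)"
      using pers_hom_closed[OF chain_maps_hom[OF \<delta>] x] .
    have dhx: "df Y (i - 1) s (h i s x) \<in> carrier (fib (ob Y i) s)"
      using pers_hom_closed[OF cochain_complex_df_pred[OF Y'(1)] pers_hom_closed[OF hom x]] .
    have hdx: "h (i + 1) s (df X i s x) \<in> carrier (fib (ob Y i) s)"
      using pers_hom_closed[OF hom pers_hom_closed[OF cochain_complex_df[OF X'(1)] x]] by simp
    consider "i > 0" | "i = 0" | "i < 0" by linarith
    then show ?thesis
    proof cases
      case 1
      then have "carrier (fib (ob Y i) s) = {\<zero>\<^bsub>fib (ob Y i) s\<^esub>}"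
        using Y'(3) by (simp add: pers_zero_def)
      then show ?thesis using \<delta>x dhx hdx by simp
    next
      case 2
      then show ?thesis using H(1)[of 0] x Y.r_zero[OF \<delta>x] by (simp add: P_def h_def)
    next
      case 3
      define n where "n = nat (- i - 1)"
      have n: "- int n - 1 = i" "h (i + 1) = H n" "h i = H (Suc n)"
        using 3 by (auto simp: n_def h_def Suc_nat_eq_nat_zadd1)
      have "df Y (i - 1) s (h i s x) = \<delta> i s x \<ominus>\<^bsub>fib (ob Y i) s\<^esub> h (i + 1) s (df X i s x)"
        using H(2)[of n] x by (simp add: Q_def n)
      \<comment> \<open>Solving \<open>Q n\<close> for \<open>\<delta>\<close> yields the two terms
        in the opposite order from the homotopy formula, hence the final commutation.\<close>
      then have "\<delta> i s x = h (i + 1) s (df X i s x) \<oplus>\<^bsub>fib (ob Y i) s\<^esub> df Y (i - 1) s (h i s x)"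
        using abelian_group_diff_eq_iff[OF Y.abelian_group_axioms \<delta>x hdx dhx] by simp
      then show ?thesis using Y.a_comm[OF dhx hdx] by simp
    qed
  qed
  with \<phi> \<psi> hom show ?thesis
    unfolding homotopy_rel_def \<delta>_def by blast
qed

section \<open>Interleavings\<close>

text \<open>Once composites and shifts of classes are computed on representatives, both sides of
  each equation are classes of chain maps into \<open>cshift (2 * \<epsilon>)\<close> of the source,
  and equality of classes is homotopy.\<close>

lemma K_interleaved_iff:
  fixes X Y :: "('n::finite, 'k, 'v) pcomplex"
  assumes X: "cochain_complex K X" and Y: "cochain_complex K Y" and "0 \<le> \<epsilon>"
  shows "K_interleaved K \<epsilon> X Y \<longleftrightarrow>
    (\<exists>\<phi>\<in>chain_maps K X (cshift \<epsilon> Y). \<exists>\<gamma>\<in>chain_maps K Y (cshift \<epsilon> X).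
      (\<lambda>i. pers_comp (pshift_map \<epsilon> (\<gamma> i)) (\<phi> i), \<lambda>i. smoothing (2 * \<epsilon>) (ob X i))
        \<in> homotopy_rel K X (cshift (2 * \<epsilon>) X) \<and>
      (\<lambda>i. pers_comp (pshift_map \<epsilon> (\<phi> i)) (\<gamma> i), \<lambda>i. smoothing (2 * \<epsilon>) (ob Y i))
        \<in> homotopy_rel K Y (cshift (2 * \<epsilon>) Y))"
    (is "_ \<longleftrightarrow> ?R")
proof -
  \<comment> \<open>Stated for a generic pair of complexes, because the two interleaving equations
    are exchanged by swapping \<open>X\<close> with \<open>Y\<close> and \<open>\<phi>\<close> with
    \<open>\<gamma>\<close>.\<close>
  have key: "K_comp K Z (cshift \<epsilon> (cshift \<epsilon> Z))
        (K_shift K W (cshift \<epsilon> Z) \<epsilon> (K_class K W (cshift \<epsilon> Z) \<gamma>)) (K_class K Z (cshift \<epsilon> W) \<phi>)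
        = K_smoothing K (2 * \<epsilon>) Z \<longleftrightarrow>
      (\<lambda>i. pers_comp (pshift_map \<epsilon> (\<gamma> i)) (\<phi> i), \<lambda>i. smoothing (2 * \<epsilon>) (ob Z i))
        \<in> homotopy_rel K Z (cshift (2 * \<epsilon>) Z)"
    if Z: "cochain_complex K Z" and W: "cochain_complex K W"
      and \<phi>: "\<phi> \<in> chain_maps K Z (cshift \<epsilon> W)" and \<gamma>: "\<gamma> \<in> chain_maps K W (cshift \<epsilon> Z)"
    for Z W :: "('n, 'k, 'v) pcomplex" and \<phi> \<gamma>
  proof -
    note \<gamma>s = chain_maps_cshift[OF \<gamma>, of \<epsilon>]
    note Z' = cochain_complex_cshift[OF Z] and W' = cochain_complex_cshift[OF W]
    have *: "K_comp K Z (cshift \<epsilon> (cshift \<epsilon> Z))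
        (K_shift K W (cshift \<epsilon> Z) \<epsilon> (K_class K W (cshift \<epsilon> Z) \<gamma>)) (K_class K Z (cshift \<epsilon> W) \<phi>)
      = K_class K Z (cshift (2 * \<epsilon>) Z) (\<lambda>i. pers_comp (pshift_map \<epsilon> (\<gamma> i)) (\<phi> i))"
      using K_comp_class[OF Z W' cochain_complex_cshift[OF Z'] \<phi> \<gamma>s]
      by (simp add: K_shift_class[OF W Z' \<gamma>] cshift_cshift)
    have "(\<lambda>i. pers_comp (pshift_map \<epsilon> (\<gamma> i)) (\<phi> i)) \<in> chain_maps K Z (cshift (2 * \<epsilon>) Z)"
      using chain_maps_comp[OF \<phi> \<gamma>s] by (simp add: cshift_cshift)
    then show ?thesis
      unfolding * K_smoothing_def
      using K_class_eq_iff[OF Z Z' _ chain_maps_smoothing[OF Z]] \<open>0 \<le> \<epsilon>\<close> by simp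
  qed
  show ?thesis
  proof
    assume "K_interleaved K \<epsilon> X Y"
    then obtain F G where F: "F \<in> K_hom K X (cshift \<epsilon> Y)" and G: "G \<in> K_hom K Y (cshift \<epsilon> X)"
      and eq: "K_comp K X (cshift \<epsilon> (cshift \<epsilon> X)) (K_shift K Y (cshift \<epsilon> X) \<epsilon> G) F = K_smoothing K (2 * \<epsilon>) X"
        "K_comp K Y (cshift \<epsilon> (cshift \<epsilon> Y)) (K_shift K X (cshift \<epsilon> Y) \<epsilon> F) G = K_smoothing K (2 * \<epsilon>) Y"
      unfolding K_interleaved_def by blast
    obtain \<phi> where \<phi>: "\<phi> \<in> chain_maps K X (cshift \<epsilon> Y)" "F = K_class K X (cshift \<epsilon> Y) \<phi>"
      using K_homE[OF F] .
    obtain \<gamma> where \<gamma>: "\<gamma> \<in> chain_maps K Y (cshift \<epsilon> X)" "G = K_class K Y (cshift \<epsilon> X) \<gamma>"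
      using K_homE[OF G] .
    show ?R
      using eq \<phi>(1) \<gamma>(1) unfolding \<phi>(2) \<gamma>(2) key[OF X Y \<phi>(1) \<gamma>(1)] key[OF Y X \<gamma>(1) \<phi>(1)] by blast
  next
    assume ?R
    then obtain \<phi> \<gamma> where \<phi>: "\<phi> \<in> chain_maps K X (cshift \<epsilon> Y)" and \<gamma>: "\<gamma> \<in> chain_maps K Y (cshift \<epsilon> X)"
      and hom: "(\<lambda>i. pers_comp (pshift_map \<epsilon> (\<gamma> i)) (\<phi> i), \<lambda>i. smoothing (2 * \<epsilon>) (ob X i))
          \<in> homotopy_rel K X (cshift (2 * \<epsilon>) X)"
        "(\<lambda>i. pers_comp (pshift_map \<epsilon> (\<phi> i)) (\<gamma> i), \<lambda>i. smoothing (2 * \<epsilon>) (ob Y i))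
          \<in> homotopy_rel K Y (cshift (2 * \<epsilon>) Y)"
      by blast
    show "K_interleaved K \<epsilon> X Y"
      unfolding K_interleaved_def
      using hom K_class_in_K_hom[OF \<phi>] K_class_in_K_hom[OF \<gamma>]
      unfolding key[OF X Y \<phi> \<gamma>, symmetric] key[OF Y X \<gamma> \<phi>, symmetric] by blast
  qed
qed

text \<open>By uniqueness of lifts, a homotopy to the smoothing exists as soon as the two chain maps
  agree in degree 0 after the shifted augmentation. That agreement is the interleaving equation of
  the modules evaluated on elements \<open>c s x\<close>.\<close>

lemma interleaved_imp_K_interleaved_resolutions:
  fixes X Y :: "('n::finite, 'k, 'v) pcomplex" and M N :: "('n, 'k, 'v) persmod"
  assumes X: "augmented_resolution K X M a" and pX: "\<And>i. pers_projective K (ob X i)"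
    and Y: "augmented_resolution K Y N b" and pY: "\<And>i. pers_projective K (ob Y i)"
    and "0 \<le> \<epsilon>" and "interleaved K \<epsilon> M N"
  shows "K_interleaved K \<epsilon> X Y"
proof -
  note X' = augmented_resolutionD[OF X] and Y' = augmented_resolutionD[OF Y]
  obtain f g where f: "f \<in> pers_hom K M (pshift \<epsilon> N)" and g: "g \<in> pers_hom K N (pshift \<epsilon> M)"
    and gf: "pers_eq M (pers_comp (pshift_map \<epsilon> g) f) (smoothing (2 * \<epsilon>) M)"
    and fg: "pers_eq N (pers_comp (pshift_map \<epsilon> f) g) (smoothing (2 * \<epsilon>) N)"
    using assms(6) unfolding interleaved_def by blast
  obtain \<phi> where \<phi>: "\<phi> \<in> chain_maps K X (cshift \<epsilon> Y)"
    and \<phi>f: "\<And>s x. x \<in> carrier (fib (ob X 0) s) \<Longrightarrow> b (s + vec \<epsilon>) (\<phi> 0 s x) = f s (a s x)"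
    by (rule comparison_exists[OF X pX augmented_resolution_cshift[OF Y] f])
      (use that in \<open>simp add: pshift_map_def\<close>)
  obtain \<gamma> where \<gamma>: "\<gamma> \<in> chain_maps K Y (cshift \<epsilon> X)"
    and \<gamma>g: "\<And>s x. x \<in> carrier (fib (ob Y 0) s) \<Longrightarrow> a (s + vec \<epsilon>) (\<gamma> 0 s x) = g s (b s x)"
    by (rule comparison_exists[OF Y pY augmented_resolution_cshift[OF X] g])
      (use that in \<open>simp add: pshift_map_def\<close>)
  have key: "(\<lambda>i. pers_comp (pshift_map \<epsilon> (\<gamma> i)) (\<phi> i), \<lambda>i. smoothing (2 * \<epsilon>) (ob Z i))
      \<in> homotopy_rel K Z (cshift (2 * \<epsilon>) Z)"
    if Z: "augmented_resolution K Z L c" and pZ: "\<And>i. pers_projective K (ob Z i)"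
      and W: "augmented_resolution K W L' c'"
      and \<phi>: "\<phi> \<in> chain_maps K Z (cshift \<epsilon> W)" and \<gamma>: "\<gamma> \<in> chain_maps K W (cshift \<epsilon> Z)"
      and \<phi>f: "\<And>s x. x \<in> carrier (fib (ob Z 0) s) \<Longrightarrow> c' (s + vec \<epsilon>) (\<phi> 0 s x) = u s (c s x)"
      and \<gamma>g: "\<And>s x. x \<in> carrier (fib (ob W 0) s) \<Longrightarrow> c (s + vec \<epsilon>) (\<gamma> 0 s x) = v s (c' s x)"
      and gf: "pers_eq L (pers_comp (pshift_map \<epsilon> v) u) (smoothing (2 * \<epsilon>) L)"
    for Z W :: "('n, 'k, 'v) pcomplex" and L L' c c' u v \<phi> \<gamma>
  proof (rule comparison_unique[OF Z pZ augmented_resolution_cshift[OF Z]])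
    note Z' = augmented_resolutionD[OF Z]
    show "(\<lambda>i. pers_comp (pshift_map \<epsilon> (\<gamma> i)) (\<phi> i)) \<in> chain_maps K Z (cshift (2 * \<epsilon>) Z)"
      using chain_maps_comp[OF \<phi> chain_maps_cshift[OF \<gamma>]] by (simp add: cshift_cshift)
    show "(\<lambda>i. smoothing (2 * \<epsilon>) (ob Z i)) \<in> chain_maps K Z (cshift (2 * \<epsilon>) Z)"
      using chain_maps_smoothing[OF Z'(1)] \<open>0 \<le> \<epsilon>\<close> by simp
    fix s x assume x: "x \<in> carrier (fib (ob Z 0) s)"
    have eps2: "s + vec \<epsilon> + vec \<epsilon> = s + vec (2 * \<epsilon>)"
      by (simp add: vec_eq_iff)
    have "\<phi> 0 s x \<in> carrier (fib (ob W 0) (s + vec \<epsilon>))"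
      using pers_hom_closed[OF chain_maps_hom[OF \<phi>] x] by simp
    then have "c (s + vec (2 * \<epsilon>)) (\<gamma> 0 (s + vec \<epsilon>) (\<phi> 0 s x)) = v (s + vec \<epsilon>) (u s (c s x))"
      using \<gamma>g \<phi>f[OF x] eps2 by metis
    also have "\<dots> = tr L s (s + vec (2 * \<epsilon>)) (c s x)"
      using gf pers_hom_closed[OF Z'(5) x]
      by (simp add: pers_eq_def pers_comp_def pshift_map_def smoothing_def)
    \<comment> \<open>Naturality of the augmentation along
      \<open>s \<le> s + vec (2 * \<epsilon>)\<close>, an inequality that holds because
      \<open>\<epsilon>\<close> is nonnegative.\<close>
    also have "\<dots> = c (s + vec (2 * \<epsilon>)) (tr (ob Z 0) s (s + vec (2 * \<epsilon>)) x)"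
      using pers_hom_tr[OF Z'(5) _ x, of "s + vec (2 * \<epsilon>)"] \<open>0 \<le> \<epsilon>\<close>
      by (simp add: zero_le_vec)
    finally show "pshift_map (2 * \<epsilon>) c s (pers_comp (pshift_map \<epsilon> (\<gamma> 0)) (\<phi> 0) s x) =
        pshift_map (2 * \<epsilon>) c s (smoothing (2 * \<epsilon>) (ob Z 0) s x)"
      by (simp add: pshift_map_def pers_comp_def smoothing_def)
  qed
  show ?thesis
    unfolding K_interleaved_iff[OF X'(1) Y'(1) \<open>0 \<le> \<epsilon>\<close>]
    using \<phi> \<gamma> key[where u = f and v = g, OF X pX Y \<phi> \<gamma> \<phi>f \<gamma>g gf]
      key[where u = g and v = f, OF Y pY X \<gamma> \<phi> \<gamma>g \<phi>f fg] by blast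
qed

text \<open>Augmentations are pointwise surjective, so each interleaving equation need only be
  tested on elements \<open>c s x\<close>. There it follows from the homotopy, which becomes an
  equality after the augmentation.\<close>

lemma K_interleaved_resolutions_imp_interleaved:
  fixes X Y :: "('n::finite, 'k, 'v) pcomplex" and M N :: "('n, 'k, 'w) persmod"
  assumes X: "augmented_resolution K X M a" and Y: "augmented_resolution K Y N b"
    and "0 \<le> \<epsilon>" and "K_interleaved K \<epsilon> X Y"
  shows "interleaved K \<epsilon> M N"
proof -
  note X' = augmented_resolutionD[OF X] and Y' = augmented_resolutionD[OF Y]
  obtain \<phi> \<gamma> where \<phi>: "\<phi> \<in> chain_maps K X (cshift \<epsilon> Y)" and \<gamma>: "\<gamma> \<in> chain_maps K Y (cshift \<epsilon> X)"
    and \<gamma>\<phi>: "(\<lambda>i. pers_comp (pshift_map \<epsilon> (\<gamma> i)) (\<phi> i), \<lambda>i. smoothing (2 * \<epsilon>) (ob X i))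
        \<in> homotopy_rel K X (cshift (2 * \<epsilon>) X)"
    and \<phi>\<gamma>: "(\<lambda>i. pers_comp (pshift_map \<epsilon> (\<phi> i)) (\<gamma> i), \<lambda>i. smoothing (2 * \<epsilon>) (ob Y i))
        \<in> homotopy_rel K Y (cshift (2 * \<epsilon>) Y)"
    using assms(4) unfolding K_interleaved_iff[OF X'(1) Y'(1) \<open>0 \<le> \<epsilon>\<close>] by blast
  obtain f where f: "f \<in> pers_hom K M (pshift \<epsilon> N)"
    and f\<phi>: "\<And>s x. x \<in> carrier (fib (ob X 0) s) \<Longrightarrow> f s (a s x) = b (s + vec \<epsilon>) (\<phi> 0 s x)"
    by (rule augmentation_induced_hom[OF X augmented_resolution_cshift[OF Y] \<phi>])
      (use that in \<open>simp add: pshift_map_def\<close>)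
  obtain g where g: "g \<in> pers_hom K N (pshift \<epsilon> M)"
    and g\<gamma>: "\<And>s x. x \<in> carrier (fib (ob Y 0) s) \<Longrightarrow> g s (b s x) = a (s + vec \<epsilon>) (\<gamma> 0 s x)"
    by (rule augmentation_induced_hom[OF Y augmented_resolution_cshift[OF X] \<gamma>])
      (use that in \<open>simp add: pshift_map_def\<close>)
  have key: "pers_eq L (pers_comp (pshift_map \<epsilon> v) u) (smoothing (2 * \<epsilon>) L)"
    if Z: "augmented_resolution K Z L c" and \<phi>: "\<phi> \<in> chain_maps K Z (cshift \<epsilon> W)"
      and hom: "(\<lambda>i. pers_comp (pshift_map \<epsilon> (\<gamma> i)) (\<phi> i), \<lambda>i. smoothing (2 * \<epsilon>) (ob Z i))
        \<in> homotopy_rel K Z (cshift (2 * \<epsilon>) Z)"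
      and u_eq: "\<And>s x. x \<in> carrier (fib (ob Z 0) s) \<Longrightarrow> u s (c s x) = c' (s + vec \<epsilon>) (\<phi> 0 s x)"
      and v_eq: "\<And>s x. x \<in> carrier (fib (ob W 0) s) \<Longrightarrow> v s (c' s x) = c (s + vec \<epsilon>) (\<gamma> 0 s x)"
    for Z W L c c' u v \<phi> \<gamma>
    unfolding pers_eq_def
  proof (intro allI ballI)
    note Z' = augmented_resolutionD[OF Z]
    fix s m assume "m \<in> carrier (fib L s)"
    then obtain x where x: "x \<in> carrier (fib (ob Z 0) s)" and m: "m = c s x"
      using Z'(6) by blast
    have eps2: "s + vec \<epsilon> + vec \<epsilon> = s + vec (2 * \<epsilon>)"
      by (simp add: vec_eq_iff)
    have "\<phi> 0 s x \<in> carrier (fib (ob W 0) (s + vec \<epsilon>))"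
      using pers_hom_closed[OF chain_maps_hom[OF \<phi>] x] by simp
    then have "v (s + vec \<epsilon>) (u s m) = c (s + vec (2 * \<epsilon>)) (\<gamma> 0 (s + vec \<epsilon>) (\<phi> 0 s x))"
      using v_eq u_eq[OF x] m eps2 by metis
    also have "\<dots> = c (s + vec (2 * \<epsilon>)) (tr (ob Z 0) s (s + vec (2 * \<epsilon>)) x)"
      using augmentation_homotopic_eq[OF Z'(1,3) augmented_resolution_cshift[OF Z] hom x]
      by (simp add: pshift_map_def pers_comp_def smoothing_def)
    also have "\<dots> = tr L s (s + vec (2 * \<epsilon>)) m"
      using pers_hom_tr[OF Z'(5) _ x, of "s + vec (2 * \<epsilon>)"] \<open>0 \<le> \<epsilon>\<close> m
      by (simp add: zero_le_vec)
    finally show "pers_comp (pshift_map \<epsilon> v) u s m = smoothing (2 * \<epsilon>) L s m"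
      by (simp add: pshift_map_def pers_comp_def smoothing_def)
  qed
  show ?thesis
    unfolding interleaved_def
  proof (intro bexI[OF _ f] bexI[OF _ g] conjI)
    show "pers_eq M (pers_comp (pshift_map \<epsilon> g) f) (smoothing (2 * \<epsilon>) M)"
      by (rule key[OF X \<phi> \<gamma>\<phi>]) (rule f\<phi>, assumption, rule g\<gamma>, assumption)
    show "pers_eq N (pers_comp (pshift_map \<epsilon> f) g) (smoothing (2 * \<epsilon>) N)"
      by (rule key[OF Y \<gamma> \<phi>\<gamma>]) (rule g\<gamma>, assumption, rule f\<phi>, assumption)
  qed
qed

section \<open>The augmentation of a projective resolution\<close>

lemma abelian_subgroup_coboundaries:
  assumes "cochain_complex K X"
  shows "abelian_subgroup (coboundaries X j s) (fib (ob X j) s)"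
  unfolding coboundaries_def
  using pers_hom_image_submodule[OF cochain_complex_ob[OF assms] cochain_complex_ob[OF assms]
      cochain_complex_df_pred[OF assms]] persistence_module_abelian_group[OF cochain_complex_ob[OF assms]]
  by (intro abelian_subgroupI3 additive_subgroupI submodule.axioms(1))

lemma coh_class_self:
  assumes "cochain_complex K X" "x \<in> carrier (fib (ob X j) s)"
  shows "x \<in> coh_class X j s x"
proof -
  interpret abelian_subgroup "coboundaries X j s" "fib (ob X j) s"
    using abelian_subgroup_coboundaries[OF assms(1)] .
  show ?thesis
    using a_rcosI[OF additive_subgroup.zero_closed[OF additive_subgroup_axioms] a_subset assms(2)] assms(2) by (simp add: coh_class_def)
qed

lemma mem_coh_class:
  assumes "cochain_complex K X" "x \<in> carrier (fib (ob X j) s)" "y \<in> coh_class X j s x"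
  shows "y \<in> carrier (fib (ob X j) s)" "coh_class X j s y = coh_class X j s x"
proof -
  interpret abelian_subgroup "coboundaries X j s" "fib (ob X j) s"
    using abelian_subgroup_coboundaries[OF assms(1)] .
  show "y \<in> carrier (fib (ob X j) s)"
    using a_r_coset_subset_G[OF a_subset assms(2)] assms(3) by (auto simp: coh_class_def)
  show "coh_class X j s y = coh_class X j s x"
    using a_repr_independence[OF _ assms(2) a_subgroup] assms(3) by (simp add: coh_class_def)
qed

lemma coh_class_add:
  assumes "cochain_complex K X" "x \<in> carrier (fib (ob X j) s)" "y \<in> carrier (fib (ob X j) s)"
  shows "coh_class X j s (x \<oplus>\<^bsub>fib (ob X j) s\<^esub> y) =
    coh_class X j s x <+>\<^bsub>fib (ob X j) s\<^esub> coh_class X j s y"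
proof -
  interpret abelian_subgroup "coboundaries X j s" "fib (ob X j) s"
    using abelian_subgroup_coboundaries[OF assms(1)] .
  show ?thesis
    using a_rcos_sum[OF assms(2,3)] by (simp add: coh_class_def)
qed

lemma coh_class_eq_coboundaries_iff:
  assumes "cochain_complex K X" "x \<in> carrier (fib (ob X j) s)"
  shows "coh_class X j s x = coboundaries X j s \<longleftrightarrow> x \<in> coboundaries X j s"
proof -
  interpret abelian_subgroup "coboundaries X j s" "fib (ob X j) s"
    using abelian_subgroup_coboundaries[OF assms(1)] .
  show ?thesis
    using a_coset_join1[OF _ assms(2) a_subgroup] a_coset_join2[OF assms(2) a_subgroup]
    by (auto simp: coh_class_def)
qed

text \<open>Scalar multiplication and transition maps on cohomology are unions over representatives;
  such a union collapses to one coset for any additive map that preserves coboundaries. The separate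
  points \<open>s\<close> and \<open>t\<close> accommodate transition maps.\<close>

lemma Union_coh_class_hom:
  assumes X: "cochain_complex K X" and Y: "cochain_complex K Y"
    and f: "\<And>y. y \<in> carrier (fib (ob X i) s) \<Longrightarrow> f y \<in> carrier (fib (ob Y j) t)"
    and f_add: "\<And>y z. \<lbrakk>y \<in> carrier (fib (ob X i) s); z \<in> carrier (fib (ob X i) s)\<rbrakk>
      \<Longrightarrow> f (y \<oplus>\<^bsub>fib (ob X i) s\<^esub> z) = f y \<oplus>\<^bsub>fib (ob Y j) t\<^esub> f z"
    and f_bd: "\<And>y. y \<in> coboundaries X i s \<Longrightarrow> f y \<in> coboundaries Y j t"
    and x: "x \<in> carrier (fib (ob X i) s)"
  shows "(\<Union>y\<in>coh_class X i s x. coh_class Y j t (f y)) = coh_class Y j t (f x)"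
proof -
  interpret X: abelian_subgroup "coboundaries X i s" "fib (ob X i) s"
    using abelian_subgroup_coboundaries[OF X] .
  interpret Y: abelian_subgroup "coboundaries Y j t" "fib (ob Y j) t"
    using abelian_subgroup_coboundaries[OF Y] .
  have "coh_class Y j t (f y) = coh_class Y j t (f x)" if "y \<in> coh_class X i s x" for y
  proof -
    obtain h where h: "h \<in> coboundaries X i s" "y = h \<oplus>\<^bsub>fib (ob X i) s\<^esub> x"
      using \<open>y \<in> _\<close> by (auto simp: coh_class_def a_r_coset_def')
    have "f y \<in> coh_class Y j t (f x)"
      using Y.a_rcosI[OF f_bd[OF h(1)] Y.a_subset f[OF x]] f_add[OF X.a_Hcarr[OF h(1)] x] h(2)
      by (simp add: coh_class_def)
    then show ?thesis using mem_coh_class(2)[OF Y f[OF x]] by blast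
  qed
  then show ?thesis using coh_class_self[OF X x] by blast
qed

text \<open>The augmentation is the class map followed by \<open>\<rho>\<close>. Surjectivity and
  the kernel condition come from the two inverse laws of \<open>\<rho>\<close>, and exactness in
  negative degrees from vanishing cohomology.\<close>

lemma augmented_resolution_of_projective_resolution:
  assumes res: "projective_resolution K M X \<rho>" and M: "persistence_module K M"
  shows "augmented_resolution K X M (\<lambda>s x. \<rho> s (coh_class X 0 s x))"
proof -
  have X: "cochain_complex K X" and zero: "\<And>i. 0 < i \<Longrightarrow> pers_zero (ob X i)"
    and acyc: "\<And>j. j \<noteq> 0 \<Longrightarrow> pers_zero (cohomology X j)"
    and \<rho>: "\<rho> \<in> pers_hom K (cohomology X 0) M"
    using res by (simp_all add: projective_resolution_def pers_iso_def)
  obtain g where g: "g \<in> pers_hom K M (cohomology X 0)"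
    and g\<rho>: "pers_eq (cohomology X 0) (pers_comp g \<rho>) pers_id"
    and \<rho>g: "pers_eq M (pers_comp \<rho> g) pers_id"
    using res by (auto simp: projective_resolution_def pers_iso_def)
  \<comment> \<open>As \<open>ob X 1\<close> is zero, every element of \<open>ob X 0\<close> is a
    cocycle and has a class, so the augmentation is meaningful on the whole fibre.\<close>
  have "cocycles X 0 s = carrier (fib (ob X 0) s)" for s
    using pers_hom_closed[OF cochain_complex_df[OF X, of 0]] zero[of 1]
    by (auto simp: cocycles_def pers_zero_def)
  then have H: "carrier (fib (cohomology X 0) s) = coh_class X 0 s ` carrier (fib (ob X 0) s)" for s
    by (simp add: cohomology_def)
  interpret V: Module.module K "fib (ob X 0) s" for s
    using persistence_module_fib[OF cochain_complex_ob[OF X]] .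
  have d: "df X (- 1) \<in> pers_hom K (ob X (- 1)) (ob X 0)"
    using cochain_complex_df[OF X, of "- 1"] by simp
  have a: "(\<lambda>s x. \<rho> s (coh_class X 0 s x)) \<in> pers_hom K (ob X 0) M"
  proof (intro pers_homI linear_mapsI)
    fix s x assume x: "x \<in> carrier (fib (ob X 0) s)"
    then have cx: "coh_class X 0 s x \<in> carrier (fib (cohomology X 0) s)" by (simp add: H)
    show "\<rho> s (coh_class X 0 s x) \<in> carrier (fib M s)"
      using pers_hom_closed[OF \<rho> cx] .
    show "\<rho> s (coh_class X 0 s (x \<oplus>\<^bsub>fib (ob X 0) s\<^esub> y)) =
        \<rho> s (coh_class X 0 s x) \<oplus>\<^bsub>fib M s\<^esub> \<rho> s (coh_class X 0 s y)"
      if y: "y \<in> carrier (fib (ob X 0) s)" for y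
    proof -
      have "coh_class X 0 s y \<in> carrier (fib (cohomology X 0) s)" using y by (simp add: H)
      from pers_hom_add[OF \<rho> cx this] show ?thesis
        by (simp add: coh_class_add[OF X x y]) (simp add: cohomology_def)
    qed
    show "\<rho> s (coh_class X 0 s (k \<odot>\<^bsub>fib (ob X 0) s\<^esub> x)) = k \<odot>\<^bsub>fib M s\<^esub> \<rho> s (coh_class X 0 s x)"
      if k: "k \<in> carrier K" for k
    proof -
      have "(\<Union>y\<in>coh_class X 0 s x. coh_class X 0 s (k \<odot>\<^bsub>fib (ob X 0) s\<^esub> y)) =
          coh_class X 0 s (k \<odot>\<^bsub>fib (ob X 0) s\<^esub> x)"
      proof (rule Union_coh_class_hom[OF X X _ _ _ x])
        show "k \<odot>\<^bsub>fib (ob X 0) s\<^esub> y \<in> coboundaries X 0 s" if "y \<in> coboundaries X 0 s" for y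
          using submodule.smult_closed[OF pers_hom_image_submodule[OF cochain_complex_ob[OF X]
                cochain_complex_ob[OF X] d] k] that by (simp add: coboundaries_def)
      qed (use k in \<open>simp_all add: V.smult_r_distr\<close>)
      then show ?thesis
        using pers_hom_smult[OF \<rho> k cx] by (simp add: cohomology_def)
    qed
    show "\<rho> t (coh_class X 0 t (tr (ob X 0) s t x)) = tr M s t (\<rho> s (coh_class X 0 s x))"
      if "s \<le> t" for t
    proof -
      note tr = persistence_module_tr[OF cochain_complex_ob[OF X] that]
      have "(\<Union>y\<in>coh_class X 0 s x. coh_class X 0 t (tr (ob X 0) s t y)) =
          coh_class X 0 t (tr (ob X 0) s t x)"
      proof (rule Union_coh_class_hom[OF X X _ _ _ x])
        show "tr (ob X 0) s t y \<in> coboundaries X 0 t" if "y \<in> coboundaries X 0 s" for y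
          using that pers_hom_tr[OF d \<open>s \<le> t\<close>, symmetric] linear_maps_closed[OF persistence_module_tr[OF cochain_complex_ob[OF X] \<open>s \<le> t\<close>]]
          by (auto simp: coboundaries_def)
      qed (simp_all add: linear_maps_simps[OF tr])
      then show ?thesis
        using pers_hom_tr[OF \<rho> that cx] by (simp add: cohomology_def)
    qed
  qed
  have surj: "carrier (fib M s) \<subseteq> (\<lambda>x. \<rho> s (coh_class X 0 s x)) ` carrier (fib (ob X 0) s)" for s
  proof
    fix m assume m: "m \<in> carrier (fib M s)"
    then obtain x where "x \<in> carrier (fib (ob X 0) s)" "g s m = coh_class X 0 s x"
      using pers_hom_closed[OF g m] by (auto simp: H)
    moreover have "\<rho> s (g s m) = m"
      using \<rho>g m by (simp add: pers_eq_def pers_comp_def pers_id_def)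
    ultimately show "m \<in> (\<lambda>x. \<rho> s (coh_class X 0 s x)) ` carrier (fib (ob X 0) s)"
      by (metis imageI)
  qed
  have ker: "\<rho> s (coh_class X 0 s x) = \<zero>\<^bsub>fib M s\<^esub> \<longleftrightarrow> x \<in> coboundaries X 0 s"
    if x: "x \<in> carrier (fib (ob X 0) s)" for s x
  proof -
    have cancel: "g s (\<rho> s (coh_class X 0 s y)) = coh_class X 0 s y" if "y \<in> carrier (fib (ob X 0) s)" for y
      using that g\<rho> by (simp add: pers_eq_def pers_comp_def pers_id_def H)
    \<comment> \<open>The zero law is taken from the augmentation, whose source
      \<open>ob X 0\<close> is known to be a persistence module; for \<open>cohomology X 0\<close>
      the module axioms are not established.\<close>
    have "\<rho> s (coh_class X 0 s \<zero>\<^bsub>fib (ob X 0) s\<^esub>) = \<zero>\<^bsub>fib M s\<^esub>"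
      using pers_hom_zero[OF cochain_complex_ob[OF X] M a] .
    then have "\<rho> s (coh_class X 0 s x) = \<zero>\<^bsub>fib M s\<^esub> \<longleftrightarrow>
        coh_class X 0 s x = coh_class X 0 s \<zero>\<^bsub>fib (ob X 0) s\<^esub>"
      using cancel[OF x] cancel[OF V.zero_closed] by metis
    moreover have "coh_class X 0 s \<zero>\<^bsub>fib (ob X 0) s\<^esub> = coboundaries X 0 s"
    proof -
      interpret B: abelian_subgroup "coboundaries X 0 s" "fib (ob X 0) s"
        using abelian_subgroup_coboundaries[OF X] .
      show ?thesis using coh_class_eq_coboundaries_iff[OF X V.zero_closed]
          additive_subgroup.zero_closed[OF B.additive_subgroup_axioms] by simp
    qed
    ultimately show ?thesis using coh_class_eq_coboundaries_iff[OF X x] by simp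
  qed
  have "cocycles X j s \<subseteq> coboundaries X j s" if "j < 0" for j s
  proof
    fix x assume x: "x \<in> cocycles X j s"
    have "coh_class X j s ` cocycles X j s = {coboundaries X j s}"
      using acyc[of j] that by (simp add: pers_zero_def cohomology_def)
    then have "coh_class X j s x = coboundaries X j s" using x by blast
    then show "x \<in> coboundaries X j s"
      using x coh_class_eq_coboundaries_iff[OF X] by (simp add: cocycles_def)
  qed
  with X M zero a surj ker show ?thesis
    by (simp add: augmented_resolution_def)
qed

theorem corollary5p14:
  fixes K :: "('k, 'r) ring_scheme"
    and P :: "('n::finite, 'k, 'v) persmod \<Rightarrow> ('n, 'k, 'v) pcomplex"
    and \<rho> :: "('n, 'k, 'v) persmod \<Rightarrow> real ^ 'n \<Rightarrow> 'v set \<Rightarrow> 'v"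
    and Pm :: "('n, 'k, 'v) persmod \<Rightarrow> ('n, 'k, 'v) persmod \<Rightarrow> (real ^ 'n \<Rightarrow> 'v \<Rightarrow> 'v)
                 \<Rightarrow> ('n, 'v, 'v) pgraded_map set"
    and M N :: "('n, 'k, 'v) persmod"
  assumes "field K"
    and "resolution_functor K P \<rho> Pm"
    and "persistence_module K M"
    and "persistence_module K N"
  shows "d_I_K K (P M) (P N) = d_I K M N"
proof -
  have res: "projective_resolution K L (P L) (\<rho> L)" if "persistence_module K L" for L
    using assms(2) that by (simp add: resolution_functor_def)
  have proj: "pers_projective K (ob (P L) i)" if "persistence_module K L" for L i
    using res[OF that] by (simp add: projective_resolution_def)
  note aug = augmented_resolution_of_projective_resolution[OF res]
  have "K_interleaved K \<epsilon> (P M) (P N) \<longleftrightarrow> interleaved K \<epsilon> M N" if "0 \<le> \<epsilon>" for \<epsilon>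
    \<comment> \<open>In \<open>assms(3,3)\<close> and \<open>assms(4,4)\<close> the same assumption
      discharges two premises: one yields the chosen resolution, the other says that the resolved
      object is a persistence module.\<close>
    using interleaved_imp_K_interleaved_resolutions[OF
        aug[OF assms(3,3)] proj[OF assms(3)] aug[OF assms(4,4)] proj[OF assms(4)] that]
      K_interleaved_resolutions_imp_interleaved[OF aug[OF assms(3,3)] aug[OF assms(4,4)] that]
    by blast
  then have "{\<epsilon>. 0 \<le> \<epsilon> \<and> K_interleaved K \<epsilon> (P M) (P N)} = {\<epsilon>. 0 \<le> \<epsilon> \<and> interleaved K \<epsilon> M N}"
    by blast
  then show ?thesis by (simp add: d_I_K_def d_I_def)
qed

end
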